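(* For any $\gamma<1/2$, there exists a probability distribution $\mu$ on $\{0,1,2,\dots\}$ with $\sum_{k\ge 0}k\mu(k)=1$, $\mu(0)>0$ and $\sum_{k\ge 0}k^2\mu(k)<\infty$ such that, if $\tau_n$ and $\tau_n'$ are two independent Bienaymé trees with the same offspring distribution $\mu$, each conditioned to have exactly $n$ vertices, then \[\lim_{n\to\infty}\mathbf{P}\big(\mathrm{LCS}(\tau_n,\tau_n')\ge \sqrt n\,\log^{\gamma} n\big)=1.\]
   Context: A Bienaymé (Galton--Watson) tree with offspring distribution $\mu$ is the random rooted family tree in which the root has a $\mu$-distributed number of children and, conditionally on this number being $k$, the $k$ subtrees rooted at these children are i.i.d. with the same law as the whole tree. Only those $n$ for which the unconditioned tree has size $n$ with positive probability are considered. Trees are viewed as graphs; a tree $t''$ is a common subtree of $t$ and $t'$ if it is isomorphic to a (not necessarily root-containing) subtree of both, and $\mathrm{LCS}(t,t')$ is the maximum number of vertices of a common subtree of $t$ and $t'$. *)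

theory Defs
  imports "HOL-Probability.Probability"
begin

section \<open>Family trees as undirected graphs\<close>

text \<open>A finite rooted family tree is given by the list of the subtrees of the children of the
  root. Its vertices are addressed by words of child indices, the root being the empty word.\<close>

datatype ptree = PNode "ptree list"

primrec is_vertex :: "nat list \<Rightarrow> ptree \<Rightarrow> bool" where
  "is_vertex [] t \<longleftrightarrow> True"
| "is_vertex (i # u) t \<longleftrightarrow> (case t of PNode ts \<Rightarrow> i < length ts \<and> is_vertex u (ts ! i))"

record 'v ugraph =
  verts :: "'v set"
  edges :: "'v set set"

definition tree_graph :: "ptree \<Rightarrow> nat list ugraph" where
  "tree_graph t = \<lparr>verts = {u. is_vertex u t},
                   edges = {{u, u @ [i]} | u i. is_vertex (u @ [i]) t}\<rparr>"

definition num_vertices :: "ptree \<Rightarrow> nat" where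
  "num_vertices t = card (verts (tree_graph t))"


section \<open>Common subtrees\<close>

definition simple_graph :: "'v ugraph \<Rightarrow> bool" where
  "simple_graph G \<longleftrightarrow> (\<forall>e\<in>edges G. e \<subseteq> verts G \<and> card e = 2)"

definition walk :: "'v ugraph \<Rightarrow> 'v list \<Rightarrow> bool" where
  "walk G p \<longleftrightarrow> p \<noteq> [] \<and> set p \<subseteq> verts G \<and> successively (\<lambda>u v. {u, v} \<in> edges G) p"

definition connected_graph :: "'v ugraph \<Rightarrow> bool" where
  "connected_graph G \<longleftrightarrow>
     (\<forall>u\<in>verts G. \<forall>v\<in>verts G. \<exists>p. walk G p \<and> hd p = u \<and> last p = v)"

definition cycle :: "'v ugraph \<Rightarrow> 'v list \<Rightarrow> bool" where
  "cycle G p \<longleftrightarrow> walk G p \<and> distinct p \<and> length p \<ge> 3 \<and> {last p, hd p} \<in> edges G"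

definition tree :: "'v ugraph \<Rightarrow> bool" where
  "tree G \<longleftrightarrow> simple_graph G \<and> verts G \<noteq> {} \<and> connected_graph G \<and> (\<nexists>p. cycle G p)"

definition subtree :: "'v ugraph \<Rightarrow> 'v ugraph \<Rightarrow> bool" where
  "subtree S G \<longleftrightarrow> tree S \<and> verts S \<subseteq> verts G \<and> edges S \<subseteq> edges G"

definition isomorphic :: "'v ugraph \<Rightarrow> 'w ugraph \<Rightarrow> bool" where
  "isomorphic G H \<longleftrightarrow>
     (\<exists>f. bij_betw f (verts G) (verts H) \<and>
          (\<forall>u\<in>verts G. \<forall>v\<in>verts G. {u, v} \<in> edges G \<longleftrightarrow> {f u, f v} \<in> edges H))"

definition common_subtree :: "'u ugraph \<Rightarrow> 'v ugraph \<Rightarrow> 'w ugraph \<Rightarrow> bool" where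
  "common_subtree T G H \<longleftrightarrow> tree T \<and>
     (\<exists>S. subtree S G \<and> isomorphic T S) \<and> (\<exists>S. subtree S H \<and> isomorphic T S)"

text \<open>Every finite tree has an isomorphic copy with vertices in \<^typ>\<open>nat\<close>, so fixing this vertex
  type for the common subtree is no restriction.\<close>

definition LCS :: "ptree \<Rightarrow> ptree \<Rightarrow> nat" where
  "LCS t t' = Max {card (verts T) | T :: nat ugraph.
                    common_subtree T (tree_graph t) (tree_graph t')}"


section \<open>Conditioned trees\<close>

primrec iid_spmf :: "nat \<Rightarrow> 'a spmf \<Rightarrow> 'a list spmf" where
  "iid_spmf 0 p = return_spmf []"
| "iid_spmf (Suc k) p = bind_spmf p (\<lambda>x. map_spmf ((#) x) (iid_spmf k p))"

lemma iid_spmf_mono [partial_function_mono]: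
  assumes "mono_spmf (\<lambda>f. F f)"
  shows "mono_spmf (\<lambda>f. iid_spmf k (F f))"
  by (induction k) (simp_all add: assms bind_spmf_mono map_spmf_mono)

text \<open>The law of the family tree, as the least solution of its distributional recursion. The
  mass missing from 1 is the probability that the family tree is infinite.\<close>

partial_function (spmf) bienayme :: "nat pmf \<Rightarrow> ptree spmf" where
  "bienayme \<mu> =
     bind_spmf (spmf_of_pmf \<mu>) (\<lambda>k. map_spmf PNode (iid_spmf k (bienayme \<mu>)))"

definition admissible_sizes :: "nat pmf \<Rightarrow> nat set" where
  "admissible_sizes \<mu> =
     {n. measure (measure_spmf (bienayme \<mu>)) {t. num_vertices t = n} > 0}"

definition conditioned_bienayme :: "nat pmf \<Rightarrow> nat \<Rightarrow> ptree spmf" where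
  "conditioned_bienayme \<mu> n = cond_spmf (bienayme \<mu>) {t. num_vertices t = n}"

end

theory Submission
  imports Defs "HOL-Real_Asymp.Real_Asymp"
begin

text \<open>
  The two trees need not be compared with each other: with high probability a conditioned tree
  contains one deterministic spider with about \<open>\<surd>n log\<^sup>\<gamma> n\<close> vertices. Take as offspring law that of
  a fair coin plus an independent \<open>H\<close> of mean \<open>1/2\<close> with \<open>P(H \<ge> D) \<approx> D\<^sup>-\<^sup>2 (log D)\<^sup>-\<^sup>1\<^sup>-\<^sup>\<epsilon>\<close>, and
  \<open>D = \<surd>n (log n)\<^sup>\<beta>\<^sup>-\<^sup>1\<close> with \<open>\<gamma> < \<beta> < 1/2\<close>. Then \<open>n P(H \<ge> D) \<rightarrow> \<infinity>\<close>, so that among the trees of size \<open>n\<close>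
  those without a vertex of degree at least \<open>D\<close> are negligible: by the cycle lemma both probabilities are
  coefficients of powers of generating functions, and the coin makes the coefficients of the \<open>n\<close>-th power
  of order \<open>n\<^sup>-\<^sup>1\<^sup>/\<^sup>2\<close>, up to the factor \<open>P(H < D)\<^sup>n\<close> for truncated offspring. A critical tree reaches height
  \<open>l\<close> with probability at least of order \<open>1/l\<close>, so below a vertex with \<open>D\<close> children more than \<open>i\<close> of the
  children have a subtree of height of order \<open>D/i\<close>, except with probability \<open>exp(-i)\<close>. Legs of these
  lengths for \<open>n\<^sup>1\<^sup>/\<^sup>8 \<le> i < n\<^sup>1\<^sup>/\<^sup>4\<close> have total length of order \<open>D log n\<close>.
\<close>

unbundle no vec_syntax and fps_syntax

section \<open>Vertices of family trees\<close>

primrec subtree_at :: "nat list \<Rightarrow> ptree \<Rightarrow> ptree" where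
  "subtree_at [] t = t"
| "subtree_at (i # u) t = (case t of PNode ts \<Rightarrow> subtree_at u (ts ! i))"

fun children :: "ptree \<Rightarrow> ptree list" where
  "children (PNode ts) = ts"

lemma is_vertex_append: "is_vertex (u @ v) t \<longleftrightarrow> is_vertex u t \<and> is_vertex v (subtree_at u t)"
  by (induction u arbitrary: t) (auto split: ptree.splits)

text \<open>The first letter of a nonempty address selects a root subtree. Events about a generation
  thereby become events about the list of root subtrees, whose entries are i.i.d. in the recursion
  of \<open>bienayme\<close>.\<close>

lemma ex_vertex_Suc:
  "(\<exists>u. is_vertex u (PNode ts) \<and> length u = Suc k \<and> Q (subtree_at u (PNode ts))) \<longleftrightarrow>
   (\<exists>t\<in>set ts. \<exists>u. is_vertex u t \<and> length u = k \<and> Q (subtree_at u t))" (is "?L \<longleftrightarrow> ?R")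
proof
  assume ?L
  then obtain i u where "is_vertex (i # u) (PNode ts)" "length u = k" "Q (subtree_at (i # u) (PNode ts))"
    by (metis length_Suc_conv)
  then show ?R by (auto intro!: bexI[of _ "ts ! i"])
next
  assume ?R
  then obtain i u where "i < length ts" "is_vertex u (ts ! i)" "length u = k" "Q (subtree_at u (ts ! i))"
    by (metis in_set_conv_nth)
  then show ?L by (intro exI[of _ "i # u"]) auto
qed

lemma all_vertex_PNode:
  "(\<forall>u. is_vertex u (PNode ts) \<longrightarrow> Q (subtree_at u (PNode ts))) \<longleftrightarrow>
   Q (PNode ts) \<and> (\<forall>t\<in>set ts. \<forall>u. is_vertex u t \<longrightarrow> Q (subtree_at u t))" (is "?L \<longleftrightarrow> ?R")
proof
  assume L: ?L
  show ?R
  proof (intro conjI ballI allI impI)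
    show "Q (PNode ts)" using L[rule_format, of "[]"] by simp
    fix t u assume "t \<in> set ts" "is_vertex u t"
    then obtain i where "i < length ts" "t = ts ! i" by (metis in_set_conv_nth)
    then show "Q (subtree_at u t)" using L[rule_format, of "i # u"] \<open>is_vertex u t\<close> by simp
  qed
next
  assume ?R
  then show ?L by (intro allI, case_tac u) auto
qed

lemma vertices_PNode:
  "{u. is_vertex u (PNode ts)} = insert [] (\<Union>i<length ts. (#) i ` {u. is_vertex u (ts ! i)})"
proof (intro set_eqI)
  fix u show "u \<in> {u. is_vertex u (PNode ts)} \<longleftrightarrow>
      u \<in> insert [] (\<Union>i<length ts. (#) i ` {u. is_vertex u (ts ! i)})"
    by (cases u) auto
qed

lemma finite_vertices: "finite {u. is_vertex u t}"
  by (induction t) (auto simp: vertices_PNode)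

lemma num_vertices_eq: "num_vertices t = card {u. is_vertex u t}"
  by (simp add: num_vertices_def tree_graph_def)

lemma num_vertices_PNode: "num_vertices (PNode ts) = Suc (\<Sum>t\<leftarrow>ts. num_vertices t)"
proof -
  have "card (\<Union>i<length ts. (#) i ` {u. is_vertex u (ts ! i)}) = (\<Sum>i<length ts. num_vertices (ts ! i))"
    by (subst card_UN_disjoint) (auto simp: finite_vertices card_image num_vertices_eq)
  also have "\<dots> = (\<Sum>t\<leftarrow>ts. num_vertices t)"
    by (simp add: sum_list_sum_nth atLeast0LessThan)
  finally show ?thesis
    unfolding num_vertices_eq[of "PNode ts"] vertices_PNode
    by (subst card_insert_disjoint) (auto simp: finite_vertices)
qed

text \<open>The \<open>length u + 1\<close> prefixes of \<open>u\<close> are distinct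
  vertices.\<close>

lemma length_vertex_less: 
  assumes "is_vertex u t"
  shows "length u < num_vertices t"
proof -
  have "inj_on (\<lambda>j. take j u) {..length u}"
    by (intro inj_onI) (metis atMost_iff length_take min.absorb2)
  moreover have "(\<lambda>j. take j u) ` {..length u} \<subseteq> {u. is_vertex u t}"
    using assms is_vertex_append by (auto, metis append_take_drop_id)
  ultimately have "card {..length u} \<le> num_vertices t"
    unfolding num_vertices_eq by (intro card_inj_on_le finite_vertices)
  then show ?thesis by simp
qed

section \<open>Common subtrees from prefix-closed sets of words\<close>

definition word_graph :: "nat list set \<Rightarrow> nat list ugraph" where
  "word_graph V = \<lparr>verts = V, edges = {{u, u @ [i]} | u i. u @ [i] \<in> V}\<rparr>"

lemma walk_trans:
  assumes "walk G p" "walk G q" "last p = hd q"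
  shows "\<exists>r. walk G r \<and> hd r = hd p \<and> last r = last q"
proof -
  obtain x q' where q: "q = x # q'" using assms(2) by (cases q) (auto simp: walk_def)
  have "walk G (p @ q')"
    using assms unfolding walk_def q
    by (cases q') (auto simp: successively_append_iff)
  moreover have "hd (p @ q') = hd p" "last (p @ q') = last q"
    using assms q by (auto simp: walk_def)
  ultimately show ?thesis by blast
qed

lemma walk_rev: "walk G p \<Longrightarrow> walk G (rev p)"
  by (simp add: walk_def insert_commute)

text \<open>Connectedness goes through the root. As to acyclicity, a vertex of maximal depth on a
  cycle would have its parent as both cyclic neighbours.\<close>

lemma tree_word_graph:
  assumes nil: "[] \<in> V" and closed: "\<And>u i. u @ [i] \<in> V \<Longrightarrow> u \<in> V"
  shows "tree (word_graph V)"
proof -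
  let ?G = "word_graph V"
  have verts: "verts ?G = V" by (simp add: word_graph_def)
  have simple: "simple_graph ?G"
    using closed by (auto simp: simple_graph_def word_graph_def card_insert_if)
  have root: "\<exists>p. walk ?G p \<and> hd p = [] \<and> last p = u" if "u \<in> V" for u
    using that
  proof (induction u rule: rev_induct)
    case Nil
    then show ?case by (intro exI[of _ "[[]]"]) (auto simp: walk_def verts)
  next
    case (snoc i u)
    then obtain p where p: "walk ?G p" "hd p = []" "last p = u" using closed by blast
    have "walk ?G (p @ [u @ [i]])"
      using p snoc.prems unfolding walk_def
      by (auto simp: successively_append_iff verts word_graph_def)
    then show ?case using p by (intro exI[of _ "p @ [u @ [i]]"]) (auto simp: walk_def)
  qed
  have conn: "connected_graph ?G"
    unfolding connected_graph_def verts
  proof (intro ballI)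
    fix u v assume "u \<in> V" "v \<in> V"
    then obtain p q where p: "walk ?G p" "hd p = []" "last p = u"
      and q: "walk ?G q" "hd q = []" "last q = v" using root by meson
    have ne: "p \<noteq> []" using p by (auto simp: walk_def)
    have "\<exists>r. walk ?G r \<and> hd r = hd (rev p) \<and> last r = last q"
      using p q ne by (intro walk_trans walk_rev) (auto simp: last_rev)
    then show "\<exists>p. walk ?G p \<and> hd p = u \<and> last p = v"
      using p q ne by (auto simp: hd_rev)
  qed
  have parent: "v = butlast u" if "{u, v} \<in> edges ?G" "length v \<le> length u" for u v
    using that by (auto simp: word_graph_def doubleton_eq_iff)
  have "\<nexists>p. cycle ?G p"
  proof
    assume "\<exists>p. cycle ?G p"
    then obtain p where p: "walk ?G p" "distinct p" "3 \<le> length p" "{last p, hd p} \<in> edges ?G"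
      by (auto simp: cycle_def)
    define L where "L = length p"
    have adj: "{p ! i, p ! (Suc i mod L)} \<in> edges ?G" if "i < L" for i
    proof (cases "Suc i = L")
      case True
      then have "p ! i = last p" "p ! (Suc i mod L) = hd p"
        using p(3) by (cases p; force simp: L_def last_conv_nth)+
      then show ?thesis using p(4) by simp
    next
      case False
      then show ?thesis using p(1) that
        by (auto simp: walk_def L_def successively_conv_nth)
    qed
    have ne: "p \<noteq> []" using p(3) by auto
    obtain i where i: "i < L" "\<And>j. j < L \<Longrightarrow> length (p ! j) \<le> length (p ! i)"
    proof -
      have fin: "finite ((\<lambda>j. length (p ! j)) ` {..<L})" "(\<lambda>j. length (p ! j)) ` {..<L} \<noteq> {}"
        using ne by (auto simp: L_def)
      obtain i where "i < L" "length (p ! i) = Max ((\<lambda>j. length (p ! j)) ` {..<L})"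
        using Max_in[OF fin] by auto
      with that show ?thesis using Max_ge[OF fin(1)] by (metis imageI lessThan_iff)
    qed
    \<comment> \<open>Positions of the cyclic successor and predecessor of \<open>i\<close>; adding
      \<open>L\<close> before subtracting 1 covers \<open>i = 0\<close>. They differ because a cycle
      has at least three vertices.\<close>
    define a b where "a = Suc i mod L" and "b = (i + L - 1) mod L"
    have lt: "a < L" "b < L" using i(1) by (auto simp: a_def b_def)
    have sb: "Suc b mod L = i"
      using i(1) by (cases i) (auto simp: b_def mod_Suc)
    have "p ! a = butlast (p ! i)"
      using adj[OF i(1)] i(2)[OF lt(1)] parent unfolding a_def by blast
    moreover have "p ! b = butlast (p ! i)"
      using adj[OF lt(2)] i(2)[OF lt(2)] parent unfolding sb by (metis insert_commute)
    ultimately have "a = b" using p(2) lt nth_eq_iff_index_eq unfolding L_def by metis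
    then show False using i(1) p(3)
      by (cases i) (auto simp: a_def b_def L_def mod_Suc split: if_splits)
  qed
  then show ?thesis using simple conn nil by (auto simp: tree_def verts)
qed

definition image_graph :: "('v \<Rightarrow> 'w) \<Rightarrow> 'v ugraph \<Rightarrow> 'w ugraph" where
  "image_graph f G = \<lparr>verts = f ` verts G, edges = image f ` edges G\<rparr>"

lemma image_graph_edge_iff:
  assumes "inj_on f (verts G)" "simple_graph G" "u \<in> verts G" "v \<in> verts G"
  shows "{f u, f v} \<in> edges (image_graph f G) \<longleftrightarrow> {u, v} \<in> edges G"
proof
  assume "{f u, f v} \<in> edges (image_graph f G)"
  then obtain e where e: "e \<in> edges G" "f ` {u, v} = f ` e" by (auto simp: image_graph_def)
  then have "{u, v} = e"
    using assms inj_on_image_eq_iff[OF assms(1), of "{u, v}" e] by (auto simp: simple_graph_def)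
  then show "{u, v} \<in> edges G" using e by simp
next
  assume "{u, v} \<in> edges G"
  then have "f ` {u, v} \<in> image f ` edges G" by (rule imageI)
  then show "{f u, f v} \<in> edges (image_graph f G)" by (simp add: image_graph_def)
qed

lemma isomorphic_image_graphs:
  assumes "simple_graph G" "inj_on f (verts G)" "inj_on g (verts G)"
  shows "isomorphic (image_graph f G) (image_graph g G)"
proof -
  let ?h = "\<lambda>x. g (inv_into (verts G) f x)"
  have h: "?h (f u) = g u" if "u \<in> verts G" for u using assms that by simp
  have "bij_betw ?h (f ` verts G) (g ` verts G)"
    using assms(3) unfolding bij_betw_def
    by (auto simp: h assms(2) inj_on_def image_iff intro!: bexI)
  moreover have "\<forall>u\<in>f ` verts G. \<forall>v\<in>f ` verts G.
      {u, v} \<in> edges (image_graph f G) \<longleftrightarrow> {?h u, ?h v} \<in> edges (image_graph g G)"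
    using assms by (auto simp: h image_graph_edge_iff simp del: inv_into_f_eq)
  ultimately show ?thesis unfolding isomorphic_def by (auto simp: image_graph_def)
qed

lemma walk_image_graph:
  assumes "walk G p"
  shows "walk (image_graph f G) (map f p)"
proof -
  have "successively (\<lambda>u v. {f u, f v} \<in> edges (image_graph f G)) p"
    using assms unfolding walk_def image_graph_def
    by (elim conjE, elim successively_mono) (use image_insert in \<open>fastforce simp: image_iff\<close>)
  then show ?thesis using assms by (auto simp: walk_def image_graph_def successively_map)
qed

text \<open>Walks are pushed forward along \<open>f\<close> for connectedness; a cycle in the image
  is pulled back along the inverse of \<open>f\<close>.\<close>

lemma tree_image_graph:
  assumes G: "tree G" and inj: "inj_on f (verts G)"
  shows "tree (image_graph f G)"
proof -
  let ?H = "image_graph f G" and ?g = "inv_into (verts G) f"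
  have simple: "simple_graph G" using G by (simp add: tree_def)
  have simple': "simple_graph ?H"
    using simple unfolding simple_graph_def
    by (auto simp: image_graph_def card_image inj_on_subset[OF inj])
  have conn: "connected_graph ?H"
    unfolding connected_graph_def
  proof (intro ballI)
    fix u v assume "u \<in> verts ?H" "v \<in> verts ?H"
    then obtain a b where ab: "a \<in> verts G" "b \<in> verts G" "u = f a" "v = f b"
      by (auto simp: image_graph_def)
    then obtain p where p: "walk G p" "hd p = a" "last p = b"
      using G by (meson tree_def connected_graph_def)
    then show "\<exists>p. walk ?H p \<and> hd p = u \<and> last p = v"
      using walk_image_graph[OF p(1), of f] ab
      by (intro exI[of _ "map f p"]) (auto simp: walk_def hd_map last_map)
  qed
  have gV: "?g u \<in> verts G" "f (?g u) = u" if "u \<in> verts ?H" for u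
    using that by (auto simp: image_graph_def inv_into_into f_inv_into_f)
  have gE: "{?g u, ?g v} \<in> edges G"
    if "{u, v} \<in> edges ?H" "u \<in> verts ?H" "v \<in> verts ?H" for u v
    using image_graph_edge_iff[OF inj simple gV(1) gV(1), OF that(2,3)] gV that by simp
  have "\<nexists>p. cycle ?H p"
  proof
    assume "\<exists>p. cycle ?H p"
    then obtain p where p: "walk ?H p" "distinct p" "3 \<le> length p" "{last p, hd p} \<in> edges ?H"
      by (auto simp: cycle_def)
    have sub: "set p \<subseteq> verts ?H" and ne: "p \<noteq> []" using p by (auto simp: walk_def)
    have "walk G (map ?g p)"
      using p(1) sub gV(1) unfolding walk_def successively_map
      by (auto elim!: successively_mono intro: gE)
    moreover have "distinct (map ?g p)"
      using p(2) sub gV(2) by (auto simp: distinct_map intro!: inj_onI) (metis subsetD)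
    moreover have "{last (map ?g p), hd (map ?g p)} \<in> edges G"
      using gE[OF p(4)] sub ne by (auto simp: last_map hd_map subset_iff)
    ultimately have "cycle G (map ?g p)" using p(3) by (simp add: cycle_def)
    then show False using G by (auto simp: tree_def)
  qed
  then show ?thesis using simple' conn G by (auto simp: tree_def image_graph_def)
qed

text \<open>\<open>V\<close> is an abstract model of the common subtree. The maps send parent-child
  edges to parent-child edges, but the root of \<open>V\<close> may land at any vertex, since common
  subtrees need not contain the root.\<close>

lemma LCS_ge_card:
  fixes V :: "nat list set"
  assumes fin: "finite V" and nil: "[] \<in> V" and closed: "\<And>u i. u @ [i] \<in> V \<Longrightarrow> u \<in> V"
    and f: "inj_on f V" "\<And>u. u \<in> V \<Longrightarrow> is_vertex (f u) t"
      "\<And>u i. u @ [i] \<in> V \<Longrightarrow> \<exists>j. f (u @ [i]) = f u @ [j]"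
    and g: "inj_on g V" "\<And>u. u \<in> V \<Longrightarrow> is_vertex (g u) t'"
      "\<And>u i. u @ [i] \<in> V \<Longrightarrow> \<exists>j. g (u @ [i]) = g u @ [j]"
  shows "card V \<le> LCS t t'"
proof -
  let ?G = "word_graph V"
  have G: "tree ?G" using nil closed by (rule tree_word_graph)
  have V: "verts ?G = V" by (simp add: word_graph_def)
  have sg: "simple_graph ?G" using G by (simp add: tree_def)
  have sub: "subtree (image_graph k ?G) (tree_graph s)"
    if k: "inj_on k V" "\<And>u. u \<in> V \<Longrightarrow> is_vertex (k u) s"
      "\<And>u i. u @ [i] \<in> V \<Longrightarrow> \<exists>j. k (u @ [i]) = k u @ [j]" for k s
  proof -
    have "k ` e \<in> edges (tree_graph s)" if e: "e \<in> edges ?G" for e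
    proof -
      obtain u i where ui: "e = {u, u @ [i]}" "u @ [i] \<in> V" using e by (auto simp: word_graph_def)
      then obtain j where "k (u @ [i]) = k u @ [j]" using k(3) by blast
      then show ?thesis using k(2)[OF ui(2)] ui(1) by (auto simp: tree_graph_def)
    qed
    then show ?thesis
      using k(1,2) G tree_image_graph[of ?G k] unfolding subtree_def
      by (auto simp: V image_graph_def tree_graph_def)
  qed
  \<comment> \<open>\<open>LCS\<close> ranges over graphs on \<open>nat\<close>, so the words are
    encoded by \<open>to_nat\<close>.\<close>
  let ?T = "image_graph to_nat ?G :: nat ugraph"
  have inj: "inj_on to_nat V" by (rule inj_on_subset[OF inj_to_nat]) simp
  have "common_subtree ?T (tree_graph t) (tree_graph t')"
    unfolding common_subtree_def
    using tree_image_graph[OF G] sub[OF f] sub[OF g]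
      isomorphic_image_graphs[OF sg, of to_nat] inj f(1) g(1) V by metis
  moreover have "card (verts ?T) = card V"
    using card_image[OF inj] by (simp add: image_graph_def V)
  ultimately have mem: "card V \<in> {card (verts T) | T :: nat ugraph.
      common_subtree T (tree_graph t) (tree_graph t')}" by force
  \<comment> \<open>\<open>Max\<close> bounds the elements of a set only if the set is finite; here
    all sizes are at most \<open>num_vertices t\<close>.\<close>
  have "card (verts T) \<le> num_vertices t"
    if "common_subtree T (tree_graph t) (tree_graph t')" for T :: "nat ugraph"
  proof -
    obtain S where S: "subtree S (tree_graph t)" "isomorphic T S"
      using \<open>common_subtree T (tree_graph t) (tree_graph t')\<close> by (auto simp: common_subtree_def)
    then have "card (verts T) = card (verts S)"
      by (auto simp: isomorphic_def bij_betw_same_card)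
    also have "\<dots> \<le> num_vertices t"
      using S(1) finite_vertices[of t]
      by (auto simp: num_vertices_def subtree_def tree_graph_def intro!: card_mono)
    finally show ?thesis .
  qed
  then have "finite {card (verts T) | T :: nat ugraph.
      common_subtree T (tree_graph t) (tree_graph t')}"
    by (intro finite_subset[OF _ finite_atMost[of "num_vertices t"]]) auto
  with mem show ?thesis unfolding LCS_def by (intro Max_ge)
qed

section \<open>Independent family trees\<close>

abbreviation (input) sprob :: "'a spmf \<Rightarrow> ('a \<Rightarrow> bool) \<Rightarrow> real" where
  "sprob p Q \<equiv> measure (measure_spmf p) {x. Q x}"

lemma sprob_bind: "sprob (bind_spmf p f) Q = (\<integral>x. sprob (f x) Q \<partial>measure_spmf p)"
  by (simp add: measure_spmf_bind o_def measure_spmf.measure_bind[where N = "count_space UNIV"])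

lemma sprob_map: "sprob (map_spmf f p) Q = sprob p (\<lambda>x. Q (f x))"
  by (simp add: measure_map_spmf vimage_def)

lemma sprob_le_1: "sprob p Q \<le> 1"
  by (rule measure_spmf.subprob_measure_le_1)

lemma sprob_mono: "(\<And>x. x \<in> set_spmf p \<Longrightarrow> P x \<Longrightarrow> Q x) \<Longrightarrow> sprob p P \<le> sprob p Q"
  by (intro measure_spmf.finite_measure_mono_AE) auto

lemma sprob_disj_le: "sprob p (\<lambda>x. P x \<or> Q x) \<le> sprob p P + sprob p Q"
  using measure_Un_le[of "{x. P x}" "measure_spmf p" "{x. Q x}"] by (simp add: Collect_disj_eq)

lemma sprob_bex_le:
  assumes "finite I"
  shows "sprob p (\<lambda>x. \<exists>i\<in>I. P i x) \<le> (\<Sum>i\<in>I. sprob p (P i))"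
  using assms
proof induction
  case (insert i I)
  have "sprob p (\<lambda>x. \<exists>i\<in>insert i I. P i x) = sprob p (\<lambda>x. P i x \<or> (\<exists>i\<in>I. P i x))" by simp
  also have "\<dots> \<le> sprob p (P i) + sprob p (\<lambda>x. \<exists>i\<in>I. P i x)" by (rule sprob_disj_le)
  finally show ?case using insert by simp
qed simp

text \<open>Only an inequality, since the total mass of an spmf may be below 1.\<close>

lemma sprob_not: "sprob p Q + sprob p (\<lambda>x. \<not> Q x) \<le> 1"
proof -
  have "sprob p Q + sprob p (\<lambda>x. \<not> Q x) = measure (measure_spmf p) ({x. Q x} \<union> {x. \<not> Q x})"
    by (rule measure_spmf.finite_measure_Union[symmetric]) auto
  also have "\<dots> \<le> 1" by (rule measure_spmf.subprob_measure_le_1)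
  finally show ?thesis .
qed

text \<open>Serves to split according to whether the first entry of an i.i.d. list satisfies
  \<open>Q\<close>.\<close>

lemma integral_spmf_split_le:
  assumes "\<And>x. 0 \<le> f x" "\<And>x. Q x \<Longrightarrow> f x \<le> a" "\<And>x. \<not> Q x \<Longrightarrow> f x \<le> b"
  shows "(\<integral>x. f x \<partial>measure_spmf p) \<le> a * sprob p Q + b * sprob p (\<lambda>x. \<not> Q x)"
proof -
  let ?g = "\<lambda>x. a * indicat_real {x. Q x} x + b * indicat_real {x. \<not> Q x} x"
  have le: "f x \<le> ?g x" for x using assms(2,3)[of x] by (auto simp: indicator_def)
  have int: "integrable (measure_spmf p) ?g"
    by (intro measure_spmf.integrable_const_bound[where B = "\<bar>a\<bar> + \<bar>b\<bar>"]) (auto simp: indicator_def)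
  have "integrable (measure_spmf p) f"
    using assms(1) le by (intro Bochner_Integration.integrable_bound[OF int]) (auto, smt (verit))
  then have "(\<integral>x. f x \<partial>measure_spmf p) \<le> (\<integral>x. ?g x \<partial>measure_spmf p)"
    using le int by (intro integral_mono)
  also have "\<dots> = a * sprob p Q + b * sprob p (\<lambda>x. \<not> Q x)"
    by (subst Bochner_Integration.integral_add)
      (auto intro!: integrable_mult_right measure_spmf.integrable_const_bound[where B = 1])
  finally show ?thesis .
qed

lemma integral_pmf_le_bound:
  fixes f :: "'a \<Rightarrow> real"
  assumes "\<And>x. 0 \<le> f x" "\<And>x. f x \<le> c"
  shows "(\<integral>x. f x \<partial>measure_pmf p) \<le> c"
proof -
  have "integrable (measure_pmf p) f"
    using assms by (intro measure_pmf.integrable_const_bound[where B = c]) auto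
  then have "(\<integral>x. f x \<partial>measure_pmf p) \<le> (\<integral>x. c \<partial>measure_pmf p)"
    using assms by (intro integral_mono) auto
  then show ?thesis by simp
qed

lemma sprob_iid_Suc:
  "sprob (iid_spmf (Suc k) p) Q = (\<integral>x. sprob (iid_spmf k p) (\<lambda>xs. Q (x # xs)) \<partial>measure_spmf p)"
  by (simp add: sprob_bind sprob_map)

lemma sprob_iid_0: "sprob (iid_spmf 0 p) Q = of_bool (Q [])"
  unfolding iid_spmf.simps by (simp add: measure_spmf_return_spmf measure_return)

lemma length_iid_spmf: "xs \<in> set_spmf (iid_spmf k p) \<Longrightarrow> length xs = k"
  by (induction k arbitrary: xs) (auto simp: set_bind_spmf)

lemma iid_spmf_add:
  "iid_spmf (j + k) p = bind_spmf (iid_spmf j p) (\<lambda>xs. map_spmf ((@) xs) (iid_spmf k p))"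
  by (induction j) (simp_all add: map_spmf_conv_bind_spmf)

lemma sprob_iid_all: "sprob (iid_spmf k p) (\<lambda>xs. \<forall>x\<in>set xs. Q x) = sprob p Q ^ k"
proof (induction k)
  case (Suc k)
  have "sprob (iid_spmf (Suc k) p) (\<lambda>xs. \<forall>x\<in>set xs. Q x) =
      (\<integral>x. indicat_real {x. Q x} x * sprob p Q ^ k \<partial>measure_spmf p)"
    unfolding sprob_iid_Suc
    by (intro Bochner_Integration.integral_cong) (auto simp: Suc split: split_indicator)
  then show ?case by simp
qed (simp add: sprob_iid_0 del: iid_spmf.simps)

lemma sprob_iid_ex_le: "sprob (iid_spmf k p) (\<lambda>xs. \<exists>x\<in>set xs. Q x) \<le> real k * sprob p Q"
proof (induction k)
  case (Suc k)
  have "sprob (iid_spmf (Suc k) p) (\<lambda>xs. \<exists>x\<in>set xs. Q x) \<le>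
      1 * sprob p Q + (real k * sprob p Q) * sprob p (\<lambda>x. \<not> Q x)"
    unfolding sprob_iid_Suc
    by (rule integral_spmf_split_le) (auto simp: Suc measure_spmf.subprob_measure_le_1)
  also have "\<dots> \<le> 1 * sprob p Q + (real k * sprob p Q) * 1"
    by (intro add_mono mult_left_mono sprob_le_1) auto
  finally show ?case by (simp add: algebra_simps)
qed (simp add: sprob_iid_0 del: iid_spmf.simps)

text \<open>Chernoff bound: Markov's inequality for \<open>2 ^ (- N)\<close>, where \<open>N\<close>
  counts the entries with \<open>Q\<close> and each entry contributes a factor of at most
  \<open>(1 + e) / 2\<close>. The induction on \<open>k\<close> carries this out without mentioning
  expectations.\<close>

lemma sprob_iid_count_le:
  assumes "sprob p (\<lambda>x. \<not> Q x) \<le> e"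
  shows "sprob (iid_spmf k p) (\<lambda>xs. length (filter Q xs) \<le> i) \<le> 2 ^ i * ((1 + e) / 2) ^ k"
proof -
  define y where "y = sprob p (\<lambda>x. \<not> Q x)"
  have e: "0 \<le> e" "y \<le> e" using assms order_trans[OF measure_nonneg assms] by (simp_all add: y_def)
  have x: "sprob p Q \<le> 1 - y" using sprob_not[of p Q] by (simp add: y_def)
  let ?r = "(1 + e) / 2"
  show ?thesis
  proof (induction k arbitrary: i)
    case (Suc k)
    show ?case
    proof (cases i)
      case 0
      \<comment> \<open>A first entry with \<open>Q\<close> already exceeds the count 0, hence the
        coefficient 0.\<close>
      have "sprob (iid_spmf (Suc k) p) (\<lambda>xs. length (filter Q xs) \<le> i) \<le>
          0 * sprob p Q + ?r ^ k * sprob p (\<lambda>x. \<not> Q x)"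
        unfolding sprob_iid_Suc 0
        by (rule integral_spmf_split_le) (use Suc[of 0] in auto)
      also have "\<dots> \<le> ?r ^ k * ?r"
        using e x sprob_le_1[of p "\<lambda>x. \<not> Q x"] unfolding y_def[symmetric] 
        by (auto intro!: mult_left_mono)
      finally show ?thesis by (simp add: 0 mult.commute)
    next
      case (Suc j)
      have "sprob (iid_spmf (Suc k) p) (\<lambda>xs. length (filter Q xs) \<le> i) \<le>
          (2 ^ j * ?r ^ k) * sprob p Q + (2 ^ i * ?r ^ k) * sprob p (\<lambda>x. \<not> Q x)"
        unfolding sprob_iid_Suc
        by (rule integral_spmf_split_le) (use Suc.IH[of i] Suc.IH[of j] Suc in auto)
      also have "\<dots> = (2 ^ i * ?r ^ k) * (sprob p Q / 2 + y)"
        by (simp add: Suc y_def algebra_simps)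
      also have "\<dots> \<le> (2 ^ i * ?r ^ k) * ?r"
        using e x by (intro mult_left_mono) auto
      finally show ?thesis by (simp only: power_Suc mult_ac)
    qed
  qed (simp add: sprob_iid_0 del: iid_spmf.simps)
qed

lemma sprob_bienayme:
  "sprob (bienayme \<mu>) Q = (\<integral>k. sprob (iid_spmf k (bienayme \<mu>)) (\<lambda>ts. Q (PNode ts)) \<partial>measure_pmf \<mu>)"
  by (subst bienayme.simps) (simp only: sprob_bind sprob_map measure_spmf_spmf_of_pmf)

text \<open>Criticality keeps the expected number of vertices per generation equal to one.\<close>

lemma sprob_ex_generation_le:
  assumes "integrable (measure_pmf \<mu>) real" "(\<integral>k. real k \<partial>measure_pmf \<mu>) \<le> 1"
  shows "sprob (bienayme \<mu>) (\<lambda>t. \<exists>u. is_vertex u t \<and> length u = k \<and> Q (subtree_at u t))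
    \<le> sprob (bienayme \<mu>) Q"
proof (induction k)
  case (Suc k)
  let ?R = "\<lambda>t. \<exists>u. is_vertex u t \<and> length u = k \<and> Q (subtree_at u t)"
  let ?p = "bienayme \<mu>"
  have "sprob ?p (\<lambda>t. \<exists>u. is_vertex u t \<and> length u = Suc k \<and> Q (subtree_at u t)) =
      (\<integral>j. sprob (iid_spmf j ?p) (\<lambda>ts. \<exists>t\<in>set ts. ?R t) \<partial>measure_pmf \<mu>)"
    unfolding sprob_bienayme[of \<mu> "\<lambda>t. \<exists>u. is_vertex u t \<and> length u = Suc k \<and> Q (subtree_at u t)"]
      ex_vertex_Suc ..
  also have "\<dots> \<le> (\<integral>j. real j * sprob ?p ?R \<partial>measure_pmf \<mu>)"
    using assms(1) by (intro integral_mono' sprob_iid_ex_le) auto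
  also have "\<dots> = (\<integral>j. real j \<partial>measure_pmf \<mu>) * sprob ?p ?R" by simp
  also have "\<dots> \<le> 1 * sprob ?p ?R" using assms(2) by (intro mult_right_mono) auto
  finally show ?case using Suc by simp
qed simp

text \<open>A tree with \<open>n\<close> vertices has height below \<open>n\<close>, so a union
  bound over \<open>n\<close> generations suffices, each costing no more than the root
  alone.\<close>

lemma sprob_ex_vertex_le:
  assumes "integrable (measure_pmf \<mu>) real" "(\<integral>k. real k \<partial>measure_pmf \<mu>) \<le> 1"
  shows "sprob (bienayme \<mu>) (\<lambda>t. num_vertices t = n \<and> (\<exists>u. is_vertex u t \<and> Q (subtree_at u t)))
    \<le> real n * sprob (bienayme \<mu>) Q"
proof -
  have "sprob (bienayme \<mu>) (\<lambda>t. num_vertices t = n \<and> (\<exists>u. is_vertex u t \<and> Q (subtree_at u t)))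
    \<le> sprob (bienayme \<mu>) (\<lambda>t. \<exists>k\<in>{..<n}. \<exists>u. is_vertex u t \<and> length u = k \<and> Q (subtree_at u t))"
    using length_vertex_less by (intro sprob_mono) blast
  also have "\<dots> \<le> (\<Sum>k<n. sprob (bienayme \<mu>) (\<lambda>t. \<exists>u. is_vertex u t \<and> length u = k \<and> Q (subtree_at u t)))"
    by (rule sprob_bex_le) simp
  also have "\<dots> \<le> (\<Sum>k<n. sprob (bienayme \<mu>) Q)"
    by (intro sum_mono sprob_ex_generation_le assms)
  finally show ?thesis by simp
qed

section \<open>Heights of critical trees\<close>

definition tall :: "nat \<Rightarrow> ptree \<Rightarrow> bool" where
  "tall h t \<longleftrightarrow> (\<exists>u. is_vertex u t \<and> length u = h)"

lemma tall_Suc: "tall (Suc h) (PNode ts) \<longleftrightarrow> (\<exists>t\<in>set ts. tall h t)"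
  using ex_vertex_Suc[of ts h "\<lambda>_. True"] by (simp add: tall_def)

text \<open>A second-order bound with \<open>k^2\<close> in place of a binomial coefficient:
  averaging it over the offspring number involves only the first two moments.\<close>

lemma power_one_minus_le:
  fixes x :: real
  assumes "0 \<le> x" "x \<le> 1"
  shows "(1 - x) ^ k \<le> 1 - real k * x + (real k)\<^sup>2 * x\<^sup>2"
proof (induction k)
  case (Suc k)
  have "(1 - x) ^ Suc k \<le> (1 - x) * (1 - real k * x + (real k)\<^sup>2 * x\<^sup>2)"
    using Suc assms by (auto intro!: mult_left_mono)
  also have "\<dots> = 1 - real (Suc k) * x + (real (Suc k))\<^sup>2 * x\<^sup>2 - (real k + 1) * x\<^sup>2 - (real k)\<^sup>2 * x ^ 3"
    by (simp add: power2_eq_square power3_eq_cube algebra_simps)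
  also have "\<dots> \<le> 1 - real (Suc k) * x + (real (Suc k))\<^sup>2 * x\<^sup>2"
    using mult_nonneg_nonneg[of "real k + 1" "x\<^sup>2"] mult_nonneg_nonneg[of "(real k)\<^sup>2" "x ^ 3"] assms
    by (smt (verit) of_nat_0_le_iff zero_le_power zero_le_power2)
  finally show ?case .
qed simp

text \<open>The lower half of Kolmogorov's estimate for survival. Passing to the next generation
  replaces \<open>e\<close> by the mean of \<open>e ^ k\<close>, and for
  \<open>e \<le> 1 - x\<close> this is at most \<open>1 - x + V * x^2\<close> with \<open>V\<close>
  the second moment. As \<open>2 * V \<le> C\<close>, the choice
  \<open>x = 1 / (C * (h + 1))\<close> closes the induction.\<close>

lemma sprob_not_tall_le:
  assumes int1: "integrable (measure_pmf \<mu>) real" and mean: "(\<integral>k. real k \<partial>measure_pmf \<mu>) = 1"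
    and int2: "integrable (measure_pmf \<mu>) (\<lambda>k. (real k)\<^sup>2)"
    and C: "1 \<le> C" "2 * (\<integral>k. (real k)\<^sup>2 \<partial>measure_pmf \<mu>) \<le> C"
  shows "sprob (bienayme \<mu>) (\<lambda>t. \<not> tall h t) \<le> 1 - 1 / (C * (real h + 1))"
proof (induction h)
  case 0
  have "tall 0 t" for t by (auto simp: tall_def intro: exI[of _ "[]"])
  then show ?case using C by simp
next
  case (Suc h)
  define V where "V = (\<integral>k. (real k)\<^sup>2 \<partial>measure_pmf \<mu>)"
  define x where "x = 1 / (C * (real h + 1))"
  have x: "0 \<le> x" "x \<le> 1" using C by (auto simp: x_def divide_simps mult_ge1_I)
  let ?e = "sprob (bienayme \<mu>) (\<lambda>t. \<not> tall h t)"
  have "sprob (bienayme \<mu>) (\<lambda>t. \<not> tall (Suc h) t) = (\<integral>k. ?e ^ k \<partial>measure_pmf \<mu>)"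
    unfolding sprob_bienayme[of \<mu> "\<lambda>t. \<not> tall (Suc h) t"] tall_Suc
    using sprob_iid_all[of _ "bienayme \<mu>" "\<lambda>t. \<not> tall h t"] by simp
  also have "\<dots> \<le> (\<integral>k. 1 - real k * x + (real k)\<^sup>2 * x\<^sup>2 \<partial>measure_pmf \<mu>)"
  proof (intro integral_mono)
    show "integrable (measure_pmf \<mu>) (\<lambda>k. ?e ^ k)"
      by (intro measure_pmf.integrable_const_bound[where B = 1]) (auto simp: sprob_le_1 power_le_one)
    fix k
    have "?e ^ k \<le> (1 - x) ^ k" using Suc by (intro power_mono) (auto simp: x_def)
    also have "\<dots> \<le> 1 - real k * x + (real k)\<^sup>2 * x\<^sup>2" by (rule power_one_minus_le[OF x])
    finally show "?e ^ k \<le> 1 - real k * x + (real k)\<^sup>2 * x\<^sup>2" .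
  qed (use int1 int2 in auto)
  also have "\<dots> = 1 - x + V * x\<^sup>2"
    using int1 int2 by (simp add: mean V_def)
  also have "\<dots> \<le> 1 - 1 / (C * (real (Suc h) + 1))"
  proof -
    have "V * x\<^sup>2 \<le> (C / 2) * x\<^sup>2" using C by (intro mult_right_mono) (auto simp: V_def)
    also have "\<dots> = (C * x) * x / 2" by (simp add: power2_eq_square)
    also have "C * x = 1 / (real h + 1)" using C by (simp add: x_def)
    also have "1 / (real h + 1) * x / 2 = x / (2 * (real h + 1))" by simp
    \<comment> \<open>Here \<open>h + 2 \<le> 2 * (h + 1)\<close>; the resulting
      \<open>x / (h + 2)\<close> is exactly the decrease of \<open>1 / (C * (h + 1))\<close> from
      \<open>h\<close> to \<open>h + 1\<close>.\<close>
    also have "\<dots> \<le> x / (real h + 2)" using x by (intro divide_left_mono) auto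
    also have "\<dots> = x - 1 / (C * (real (Suc h) + 1))"
    proof -
      have "1 / (C * a) / (a + 1) = 1 / (C * a) - 1 / (C * (a + 1))" if "a > 0" for a
        using C that by (simp add: divide_simps)
      from this[of "real h + 1"] show ?thesis by (simp add: x_def add_ac)
    qed
    finally show ?thesis by simp
  qed
  finally show ?case .
qed

text \<open>The failure event for leg \<open>i\<close> at a candidate centre. A vertex with
  \<open>D\<close> children that is not bad offers more than \<open>i\<close> subtrees for this leg,
  the supply that \<open>greedy_choice\<close> asks for.\<close>

definition bad_root :: "nat \<Rightarrow> nat \<Rightarrow> nat \<Rightarrow> ptree \<Rightarrow> bool" where
  "bad_root D l i t \<longleftrightarrow> D \<le> length (children t) \<and> length (filter (tall l) (children t)) \<le> i"

lemma sprob_bad_root_le: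
  assumes "sprob (bienayme \<mu>) (\<lambda>t. \<not> tall l t) \<le> e" "e \<le> 1"
  shows "sprob (bienayme \<mu>) (bad_root D l i) \<le> 2 ^ i * ((1 + e) / 2) ^ D"
  unfolding sprob_bienayme[of \<mu> "bad_root D l i"]
proof (rule integral_pmf_le_bound)
  fix k
  have e: "0 \<le> e" using assms(1) measure_nonneg order_trans by blast
  show "sprob (iid_spmf k (bienayme \<mu>)) (\<lambda>ts. bad_root D l i (PNode ts)) \<le> 2 ^ i * ((1 + e) / 2) ^ D"
  proof (cases "D \<le> k")
    case True
    have "sprob (iid_spmf k (bienayme \<mu>)) (\<lambda>ts. bad_root D l i (PNode ts)) \<le>
        sprob (iid_spmf k (bienayme \<mu>)) (\<lambda>ts. length (filter (tall l) ts) \<le> i)"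
      by (intro sprob_mono) (auto simp: bad_root_def)
    also have "\<dots> \<le> 2 ^ i * ((1 + e) / 2) ^ k" by (rule sprob_iid_count_le[OF assms(1)])
    also have "\<dots> \<le> 2 ^ i * ((1 + e) / 2) ^ D"
      using True e assms(2) by (intro mult_left_mono power_decreasing) auto
    finally show ?thesis .
  next
    case False
    then have "sprob (iid_spmf k (bienayme \<mu>)) (\<lambda>ts. bad_root D l i (PNode ts)) \<le>
        sprob (iid_spmf k (bienayme \<mu>)) (\<lambda>_. False)"
      by (intro sprob_mono) (auto simp: bad_root_def dest: length_iid_spmf)
    then have "sprob (iid_spmf k (bienayme \<mu>)) (\<lambda>ts. bad_root D l i (PNode ts)) \<le> 0" by simp
    also have "0 \<le> 2 ^ i * ((1 + e) / 2) ^ D" using e by simp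
    finally show ?thesis .
  qed
qed simp

section \<open>Coefficients of powers of generating functions\<close>

lemma fps_mult_nonneg:
  fixes A B :: "real fps"
  assumes "\<And>i. 0 \<le> A $ i" "\<And>i. 0 \<le> B $ i"
  shows "0 \<le> (A * B) $ i"
  unfolding fps_mult_nth using assms by (intro sum_nonneg) auto

lemma fps_power_nonneg:
  fixes A :: "real fps"
  assumes "\<And>i. 0 \<le> A $ i"
  shows "0 \<le> (A ^ n) $ i"
  using assms by (induction n arbitrary: i) (auto intro!: fps_mult_nonneg)

lemma fps_power_mono:
  fixes A B :: "real fps"
  assumes "\<And>i. 0 \<le> A $ i" "\<And>i. A $ i \<le> B $ i"
  shows "(A ^ n) $ i \<le> (B ^ n) $ i"
proof (induction n arbitrary: i)
  case (Suc n)
  have "0 \<le> B $ i" for i using assms order_trans by blast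
  then show ?case
    unfolding power_Suc fps_mult_nth
    using assms Suc by (intro sum_mono mult_mono) (auto intro!: fps_power_nonneg)
qed simp

text \<open>Masses multiply under convolution. For partial sums this is the inclusion of the
  triangle \<open>i + j \<le> N\<close> in a square, so no convergence is involved.\<close>

lemma fps_power_partial_sum_le:
  fixes A :: "real fps"
  assumes nonneg: "\<And>i. 0 \<le> A $ i" and le: "\<And>N. (\<Sum>i\<le>N. A $ i) \<le> S"
  shows "(\<Sum>i\<le>N. (A ^ n) $ i) \<le> S ^ n"
proof (induction n)
  case 0
  then show ?case by (simp add: sum.delta fps_one_nth)
next
  case (Suc n)
  have S: "0 \<le> S" using le[of 0] nonneg[of 0] by simp
  have "(\<Sum>i\<le>N. (A ^ Suc n) $ i) = (\<Sum>k\<le>N. \<Sum>i\<le>k. A $ i * (A ^ n) $ (k - i))"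
    by (simp add: fps_mult_nth atMost_atLeast0)
  also have "\<dots> = (\<Sum>(i, j)\<in>{(i, j). i + j \<le> N}. A $ i * (A ^ n) $ j)"
    by (rule sum.triangle_reindex_eq[symmetric])
  also have "\<dots> \<le> (\<Sum>(i, j)\<in>{..N} \<times> {..N}. A $ i * (A ^ n) $ j)"
    using nonneg by (intro sum_mono2) (auto intro!: mult_nonneg_nonneg fps_power_nonneg)
  also have "\<dots> = (\<Sum>i\<le>N. A $ i) * (\<Sum>j\<le>N. (A ^ n) $ j)"
    by (simp add: sum_product sum.cartesian_product)
  also have "\<dots> \<le> S * S ^ n"
    using Suc le S nonneg by (intro mult_mono sum_nonneg fps_power_nonneg) auto
  finally show ?case by simp
qed

text \<open>\<open>A ^ n\<close> is the law of a sum of \<open>n\<close> independent variables with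
  law \<open>A\<close>. Adding one more is a Cauchy product, in which \<open>k = i + (k - i)\<close>
  and its square split into sums of products of moments.\<close>

lemma fps_power_moments:
  fixes A :: "real fps"
  assumes nonneg: "\<And>i. 0 \<le> A $ i" and s0: "(\<lambda>i. A $ i) sums 1"
    and s1: "(\<lambda>i. real i * A $ i) sums m" and s2: "(\<lambda>i. (real i)\<^sup>2 * A $ i) sums v"
  shows "(\<lambda>i. (A ^ n) $ i) sums 1 \<and> (\<lambda>i. real i * (A ^ n) $ i) sums (real n * m) \<and>
    (\<lambda>i. (real i)\<^sup>2 * (A ^ n) $ i) sums (real n * v + real n * (real n - 1) * m\<^sup>2)"
proof (induction n)
  case 0
  have "(\<lambda>i. real i * (A ^ 0) $ i) = (\<lambda>i. 0)" "(\<lambda>i. (real i)\<^sup>2 * (A ^ 0) $ i) = (\<lambda>i. 0)"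
    by (auto simp: fps_one_nth)
  moreover have "(\<lambda>i. (A ^ 0) $ i) sums 1"
    using sums_single[of 0 "\<lambda>_. 1 :: real"] by (simp add: fps_one_nth)
  ultimately show ?case by simp
next
  case (Suc n)
  let ?B = "A ^ n"
  define B1 B2 where "B1 = real n * m" and "B2 = real n * v + real n * (real n - 1) * m\<^sup>2"
  have t: "(\<lambda>i. ?B $ i) sums 1" "(\<lambda>i. real i * ?B $ i) sums B1" "(\<lambda>i. (real i)\<^sup>2 * ?B $ i) sums B2"
    using Suc by (auto simp: B1_def B2_def)
  have nB: "0 \<le> ?B $ i" for i using nonneg by (rule fps_power_nonneg)
  have cauchy: "(\<lambda>k. \<Sum>i\<le>k. a i * b (k - i)) sums (x * y)"
    if "a sums x" "b sums y" "\<And>i. 0 \<le> a i" "\<And>i. 0 \<le> b i" for a b :: "nat \<Rightarrow> real" and x y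
    using Cauchy_product_sums[of a b] that by (simp add: sums_iff)
  have P: "(A * ?B) $ k = (\<Sum>i\<le>k. A $ i * ?B $ (k - i))" for k
    by (simp add: fps_mult_nth atMost_atLeast0)
  have "(\<lambda>k. \<Sum>i\<le>k. A $ i * ?B $ (k - i)) sums (1 * 1)"
    by (intro cauchy s0 t nonneg nB)
  then have 0: "(\<lambda>k. (A * ?B) $ k) sums 1" by (simp add: P)
  have "(\<lambda>k. (\<Sum>i\<le>k. (real i * A $ i) * ?B $ (k - i)) + (\<Sum>i\<le>k. A $ i * (real (k - i) * ?B $ (k - i))))
      sums (m * 1 + 1 * B1)"
    using nonneg nB by (intro sums_add cauchy[of "\<lambda>i. real i * A $ i"] cauchy[of _ _ "\<lambda>i. real i * ?B $ i"]
        cauchy[of _ _ "\<lambda>i. ?B $ i"] s0 s1 t) auto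
  moreover have "(\<Sum>i\<le>k. (real i * A $ i) * ?B $ (k - i)) + (\<Sum>i\<le>k. A $ i * (real (k - i) * ?B $ (k - i)))
      = real k * (A * ?B) $ k" for k
    unfolding P sum_distrib_left sum.distrib[symmetric]
    by (intro sum.cong refl) (auto simp: of_nat_diff algebra_simps)
  ultimately have 1: "(\<lambda>k. real k * (A * ?B) $ k) sums (m + B1)" by simp
  have "(\<lambda>k. (\<Sum>i\<le>k. ((real i)\<^sup>2 * A $ i) * ?B $ (k - i)) +
       2 * (\<Sum>i\<le>k. (real i * A $ i) * (real (k - i) * ?B $ (k - i))) +
       (\<Sum>i\<le>k. A $ i * ((real (k - i))\<^sup>2 * ?B $ (k - i))))
      sums (v * 1 + 2 * (m * B1) + 1 * B2)"
    using nonneg nB by (intro sums_add sums_mult cauchy[of "\<lambda>i. (real i)\<^sup>2 * A $ i"]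
        cauchy[of "\<lambda>i. real i * A $ i"] cauchy[of "\<lambda>i. A $ i"]
        cauchy[of _ _ "\<lambda>i. (real i)\<^sup>2 * ?B $ i"] s0 s1 s2 t) auto
  moreover have "(\<Sum>i\<le>k. ((real i)\<^sup>2 * A $ i) * ?B $ (k - i)) +
       2 * (\<Sum>i\<le>k. (real i * A $ i) * (real (k - i) * ?B $ (k - i))) +
       (\<Sum>i\<le>k. A $ i * ((real (k - i))\<^sup>2 * ?B $ (k - i))) = (real k)\<^sup>2 * (A * ?B) $ k" for k
    unfolding P sum_distrib_left sum.distrib[symmetric]
    by (intro sum.cong refl) (auto simp: of_nat_diff algebra_simps power2_eq_square)
  ultimately have 2: "(\<lambda>k. (real k)\<^sup>2 * (A * ?B) $ k) sums (v + 2 * (m * B1) + B2)" by simp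
  show ?case using 0 1 2 by (simp add: B1_def B2_def algebra_simps power2_eq_square)
qed

text \<open>Chebyshev's inequality: the variance is \<open>n * (v - m^2)\<close>, hence at most
  \<open>n * v\<close>, and \<open>2 * v \<le> R^2\<close>.\<close>

lemma fps_power_concentration:
  fixes A :: "real fps"
  assumes nonneg: "\<And>i. 0 \<le> A $ i" and s0: "(\<lambda>i. A $ i) sums 1"
    and s1: "(\<lambda>i. real i * A $ i) sums m" and s2: "(\<lambda>i. (real i)\<^sup>2 * A $ i) sums v"
    and n: "0 < n" and R: "2 * v \<le> R\<^sup>2" "0 < R"
    and W: "finite W" "\<And>i. \<bar>real i - real n * m\<bar> < R * sqrt (real n) \<Longrightarrow> i \<in> W"
  shows "1 / 2 \<le> (\<Sum>i\<in>W. (A ^ n) $ i)"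
proof -
  let ?B = "A ^ n" and ?M = "real n * m"
  have nB: "0 \<le> ?B $ i" for i using nonneg by (rule fps_power_nonneg)
  note mom = fps_power_moments[OF nonneg s0 s1 s2, of n]
  have "(\<lambda>i. (real i)\<^sup>2 * ?B $ i - 2 * ?M * (real i * ?B $ i) + ?M\<^sup>2 * ?B $ i) sums
      ((real n * v + real n * (real n - 1) * m\<^sup>2) - 2 * ?M * ?M + ?M\<^sup>2 * 1)"
    using mom by (intro sums_add sums_diff sums_mult) auto
  moreover have "(\<lambda>i. (real i)\<^sup>2 * ?B $ i - 2 * ?M * (real i * ?B $ i) + ?M\<^sup>2 * ?B $ i) =
      (\<lambda>i. (real i - ?M)\<^sup>2 * ?B $ i)"
    by (auto simp: power2_eq_square algebra_simps)
  ultimately have var: "(\<lambda>i. (real i - ?M)\<^sup>2 * ?B $ i) sums (real n * (v - m\<^sup>2))"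
    by (simp add: power2_eq_square algebra_simps)
  have out: "(\<lambda>i. ?B $ i - (if i \<in> W then ?B $ i else 0)) sums (1 - (\<Sum>i\<in>W. ?B $ i))"
    using mom W(1) by (intro sums_diff sums_If_finite_set) auto
  have "1 - (\<Sum>i\<in>W. ?B $ i) \<le> (1 / (R\<^sup>2 * real n)) * (real n * (v - m\<^sup>2))"
  proof (rule sums_le[OF _ out sums_mult[OF var]])
    fix i
    show "?B $ i - (if i \<in> W then ?B $ i else 0) \<le> 1 / (R\<^sup>2 * real n) * ((real i - ?M)\<^sup>2 * ?B $ i)"
    proof (cases "i \<in> W")
      case False
      then have "R * sqrt (real n) \<le> \<bar>real i - ?M\<bar>" using W(2) by force
      then have "(R * sqrt (real n))\<^sup>2 \<le> \<bar>real i - ?M\<bar>\<^sup>2" using R by (intro power_mono) auto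
      then have "R\<^sup>2 * real n \<le> (real i - ?M)\<^sup>2" by (simp add: power_mult_distrib)
      then have "(R\<^sup>2 * real n) * ?B $ i \<le> (real i - ?M)\<^sup>2 * ?B $ i"
        using nB by (intro mult_right_mono) auto
      then show ?thesis using False n R by (simp add: field_simps)
    qed (use nB in simp)
  qed
  also have "\<dots> = (v - m\<^sup>2) / R\<^sup>2" using n by simp
  also have "\<dots> \<le> 1 / 2"
  proof -
    have "2 * (v - m\<^sup>2) \<le> R\<^sup>2" using R(1) zero_le_power2[of m] by (smt (verit))
    then show ?thesis using R(2) by (simp add: field_simps)
  qed
  finally show ?thesis by simp
qed

section \<open>Binomial probabilities near the centre\<close>

lemma central_binomial_Suc:
  "real ((2 * Suc m) choose Suc m) / 4 ^ Suc m =
    (2 * real m + 1) / (2 * real m + 2) * (real ((2 * m) choose m) / 4 ^ m)"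
proof -
  have "Suc m * (Suc (2 * m + 1) choose Suc m) = Suc (2 * m + 1) * ((2 * m + 1) choose m)"
    by (rule Suc_times_binomial)
  moreover have "(2 * m + 1) choose m = (2 * m + 1) choose Suc m"
    using binomial_symmetric[of m "2 * m + 1"] by simp
  moreover have "Suc m * ((2 * m + 1) choose Suc m) = (2 * m + 1) * ((2 * m) choose m)"
    using Suc_times_binomial[of m "2 * m"] by simp
  ultimately have "Suc m * ((2 * Suc m) choose Suc m) = 2 * ((2 * m + 1) * ((2 * m) choose m))"
    by (metis (no_types, opaque_lifting) Suc_eq_plus1 add_Suc_right mult.assoc mult.left_commute mult_2_right
        mult_Suc_right numeral_2_eq_2 add_2_eq_Suc)
  then have "real (Suc m * ((2 * Suc m) choose Suc m)) = real (2 * ((2 * m + 1) * ((2 * m) choose m)))"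
    by (simp only:)
  then have eq: "(1 + real m) * real ((2 * Suc m) choose Suc m) = 2 * ((2 * real m + 1) * real ((2 * m) choose m))"
    by (simp only: of_nat_mult of_nat_add of_nat_Suc of_nat_numeral of_nat_1)
  have "b' / (4 * p) = (2 * x + 1) / (2 * x + 2) * (b / p)"
    if "(1 + x) * b' = 2 * ((2 * x + 1) * b)" "p > 0" "x \<ge> 0" for x b b' p :: real
  proof -
    have "b' = 2 * ((2 * x + 1) * b) / (1 + x)" using that by (simp add: nonzero_eq_divide_eq mult.commute)
    then show ?thesis using that by (simp add: divide_simps) (simp add: algebra_simps)
  qed
  from this[OF eq, of "4 ^ m"] show ?thesis by simp
qed

text \<open>The induction step amounts to
  \<open>(2 * m + 1) * (2 * m + 3) \<le> (2 * m + 2)^2\<close>.\<close>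

lemma central_binomial_upper:
  "real ((2 * m) choose m) / 4 ^ m \<le> 1 / sqrt (2 * real m + 1)"
proof (induction m)
  case (Suc m)
  let ?c = "\<lambda>m. real ((2 * m) choose m) / 4 ^ m"
  have "?c (Suc m) = (2 * real m + 1) / (2 * real m + 2) * ?c m"
    by (rule central_binomial_Suc)
  also have "\<dots> \<le> (2 * real m + 1) / (2 * real m + 2) * (1 / sqrt (2 * real m + 1))"
    using Suc by (intro mult_left_mono) auto
  also have "\<dots> = sqrt ((2 * real m + 1) / (2 * real m + 2)\<^sup>2)"
  proof -
    have "y / z * (1 / sqrt y) = sqrt (y / z\<^sup>2)" if "0 \<le> y" "0 < z" for y z :: real
    proof -
      have "y / z * (1 / sqrt y) = (y / sqrt y) / z" by simp
      then show ?thesis using that by (simp only: real_div_sqrt) (simp add: real_sqrt_divide)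
    qed
    then show ?thesis by simp
  qed
  also have "\<dots> \<le> sqrt (1 / (2 * real (Suc m) + 1))"
  proof (intro real_sqrt_le_mono)
    have "a / b \<le> 1 / c" if "a * c \<le> b" "0 < b" "0 < c" for a b c :: real
      using that by (simp add: field_simps)
    then show "(2 * real m + 1) / (2 * real m + 2)\<^sup>2 \<le> 1 / (2 * real (Suc m) + 1)"
      by (simp add: power2_eq_square algebra_simps add_pos_nonneg)
  qed
  finally show ?case by (simp add: real_sqrt_divide)
qed simp

lemma central_binomial_lower:
  "1 / (2 * sqrt (real m)) \<le> real ((2 * m) choose m) / 4 ^ m"
proof (induction m)
  case (Suc m)
  let ?c = "\<lambda>m. real ((2 * m) choose m) / 4 ^ m"
  show ?case
  \<comment> \<open>At 0 the bound reads \<open>1 / 0 = 0\<close> and says nothing, so the value at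
    1 is computed directly. Afterwards the step amounts to
    \<open>4 * m * (m + 1) \<le> (2 * m + 1)^2\<close>.\<close>
  proof (cases "m = 0")
    case False
    have "1 / (2 * sqrt (real (Suc m))) = sqrt (1 / (4 * (real m + 1)))"
      using real_sqrt_mult[of 4 "real m + 1"] by (simp add: real_sqrt_divide add_ac)
    also have "\<dots> \<le> sqrt ((2 * real m + 1)\<^sup>2 / ((2 * real m + 2)\<^sup>2 * (4 * real m)))"
      using False by (intro real_sqrt_le_mono) (simp add: divide_simps power2_eq_square, simp add: algebra_simps)
    also have "\<dots> = (2 * real m + 1) / (2 * real m + 2) * (1 / (2 * sqrt (real m)))"
      by (simp add: real_sqrt_divide real_sqrt_mult)
    also have "\<dots> \<le> (2 * real m + 1) / (2 * real m + 2) * ?c m"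
      using Suc by (intro mult_left_mono) auto
    also have "\<dots> = ?c (Suc m)"
      by (rule central_binomial_Suc[symmetric])
    finally show ?thesis .
  qed simp
qed simp

lemma binomial_upper:
  assumes "0 < n"
  shows "real (n choose k) / 2 ^ n \<le> 1 / sqrt (real n)"
proof (cases "even n")
  case True
  then obtain m where n: "n = 2 * m" by blast
  have "real (n choose k) \<le> real ((2 * m) choose m)"
    using binomial_maximum'[of m k] by (simp add: n)
  then have "real (n choose k) / 2 ^ n \<le> real ((2 * m) choose m) / 4 ^ m"
    by (simp add: n power_mult divide_right_mono)
  also have "\<dots> \<le> 1 / sqrt (2 * real m + 1)" by (rule central_binomial_upper)
  also have "\<dots> \<le> 1 / sqrt (real n)"
    using assms by (auto simp: n intro!: divide_left_mono mult_pos_pos)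
  finally show ?thesis .
next
  case False
  then obtain m where n: "n = 2 * m + 1" by (auto elim: oddE)
  have "(n choose k) \<le> (n choose m)"
    using binomial_maximum[of n k] by (simp add: n)
  \<comment> \<open>In an odd row the two middle coefficients coincide and add up to the central one
    of the next row.\<close>
  moreover have "2 * (n choose m) = (2 * Suc m) choose Suc m"
    using binomial_symmetric[of m "2 * m + 1"] by (simp add: n)
  ultimately have "2 * real (n choose k) \<le> real ((2 * Suc m) choose Suc m)"
    by (metis mult_le_mono2 of_nat_le_iff of_nat_mult of_nat_numeral)
  moreover have "2 * 2 ^ n = (4 :: real) ^ Suc m" by (simp add: n power_mult)
  ultimately have "real (n choose k) / 2 ^ n \<le> real ((2 * Suc m) choose Suc m) / 4 ^ Suc m"
    using divide_right_mono[of "2 * real (n choose k)" _ "2 * 2 ^ n"] by simp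
  also have "\<dots> \<le> 1 / sqrt (2 * real (Suc m) + 1)" by (rule central_binomial_upper)
  also have "\<dots> \<le> 1 / sqrt (real n)" by (auto simp: n intro!: divide_left_mono)
  finally show ?thesis .
qed

lemma one_minus_ge_exp:
  fixes x :: real
  assumes "0 \<le> x" "x \<le> 1 / 2"
  shows "exp (- 2 * x) \<le> 1 - x"
proof -
  have "exp (- 2 * x) \<le> 1 / (1 + 2 * x)"
    using exp_ge_add_one_self[of "2 * x"] assms by (simp add: exp_minus field_simps)
  also have "\<dots> \<le> 1 - x"
    using assms mult_nonneg_nonneg[of x "1 - 2 * x"] by (simp add: field_simps)
  finally show ?thesis .
qed

text \<open>For \<open>i < j\<close> the ratio of the coefficients at \<open>m + i + 1\<close> and
  \<open>m + i\<close> is \<open>(m - i) / (m + i + 1)\<close>, at least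
  \<open>1 - 2 * j / m\<close> and so at least \<open>q\<close>; \<open>j\<close> such factors are
  multiplied. The hypothesis gives \<open>2 * j / m \<le> 1 / 2\<close>, as
  \<open>one_minus_ge_exp\<close> demands.\<close>

lemma binomial_off_centre:
  assumes "4 * j \<le> m"
  shows "exp (- 4 * (real j)\<^sup>2 / real m) * real ((2 * m) choose m) \<le> real ((2 * m) choose (m + j))"
proof (cases "m = 0")
  case False
  define q where "q = exp (- 4 * real j / real m)"
  have "q ^ i * real ((2 * m) choose m) \<le> real ((2 * m) choose (m + i))" if "i \<le> j" for i
    using that
  proof (induction i)
    case (Suc i)
    have m: "real m > 0" using False by simp
    have "q = exp (- 2 * (2 * real j / real m))" by (simp add: q_def)
    also have "\<dots> \<le> 1 - 2 * real j / real m"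
      using assms m by (intro one_minus_ge_exp) (auto simp: field_simps)
    also have "\<dots> \<le> real (m - i) / real (m + i + 1)"
    proof -
      have "i \<le> m" "2 * i + 1 \<le> 2 * j" using Suc.prems assms by auto
      then have "real (m - i) = real m - real i" "2 * real i + 1 \<le> 2 * real j" by linarith+
      moreover have "(2 * real i + 1) / (real m + real i + 1) \<le> 2 * real j / real m"
        using m calculation by (intro frac_le) auto
      moreover have "(real m - real i) / (real m + real i + 1) =
          1 - (2 * real i + 1) / (real m + real i + 1)" by (simp add: field_simps)
      ultimately show ?thesis by (simp add: add_ac)
    qed
    finally have q: "q \<le> real (m - i) / real (m + i + 1)" .
    have "2 * m - (m + i) = m - i" by simp
    then have "(m + i + 1) * ((2 * m) choose (m + i + 1)) = (m - i) * ((2 * m) choose (m + i))"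
      using binomial_absorb_comp[of "2 * m" "m + i"] binomial_absorption[of "m + i" "2 * m"]
      by (metis Suc_eq_plus1)
    then have "real (m + i + 1) * real ((2 * m) choose (m + i + 1)) =
        real (m - i) * real ((2 * m) choose (m + i))" by (metis of_nat_mult)
    then have eq: "real ((2 * m) choose (m + Suc i)) =
        real (m - i) / real (m + i + 1) * real ((2 * m) choose (m + i))"
      by (simp add: field_simps)
    have "q ^ Suc i * real ((2 * m) choose m) = q * (q ^ i * real ((2 * m) choose m))" by simp
    also have "\<dots> \<le> real (m - i) / real (m + i + 1) * real ((2 * m) choose (m + i))"
      using q Suc by (intro mult_mono) (auto simp: q_def)
    finally show ?case using eq by simp
  qed simp
  from this[of j] show ?thesis
    by (simp add: q_def exp_of_nat_mult[symmetric] power2_eq_square algebra_simps)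
qed (use assms in simp)

text \<open>The lower half of a local limit theorem, uniform over a window of \<open>A\<close> times
  \<open>sqrt n\<close> around the centre.\<close>

lemma binomial_local_lower:
  fixes A :: real
  assumes "0 \<le> A"
  shows "\<exists>c>0. \<exists>N. \<forall>n\<ge>N. \<forall>s. \<bar>real s - real n / 2\<bar> \<le> A * sqrt (real n) \<longrightarrow>
    c / sqrt (real n) \<le> real (n choose s) / 2 ^ n"
proof -
  \<comment> \<open>\<open>K\<close> is chosen to bound \<open>j^2 / m\<close>, where
    \<open>j\<close> is the distance of \<open>s\<close> from the middle \<open>m\<close> of the row
    \<open>2 * m\<close>. Then \<open>m \<ge> 16 * K\<close> forces \<open>4 * j \<le> m\<close>,
    which explains the threshold for \<open>n\<close>.\<close>
  define K where "K = 6 * A\<^sup>2 + 1"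
  have K: "K \<ge> 1" by (simp add: K_def)
  have "exp (- 4 * K) / 4 / sqrt (real n) \<le> real (n choose s) / 2 ^ n"
    if n: "nat \<lceil>32 * K\<rceil> + 2 \<le> n" and s: "\<bar>real s - real n / 2\<bar> \<le> A * sqrt (real n)" for n s
  proof -
    define m where "m = n div 2"
    define j where "j = nat \<bar>int s - int m\<bar>"
    have nm: "n = 2 * m \<or> n = Suc (2 * m)" by (auto simp: m_def)
    have "32 * K + 2 \<le> real n" using n K by linarith
    then have m: "16 * K \<le> real m" "1 \<le> real m" using nm K by auto
    have jr: "real j = \<bar>real s - real m\<bar>" by (simp add: j_def)
    have "real n = 2 * real m \<or> real n = 2 * real m + 1" using nm by auto
    then have "real j \<le> A * sqrt (real n) + 1 / 2" using s unfolding jr by linarith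
    then have "(real j)\<^sup>2 \<le> (A * sqrt (real n) + 1 / 2)\<^sup>2" by (intro power_mono) auto
    also have "\<dots> \<le> 2 * (A * sqrt (real n))\<^sup>2 + 2 * (1 / 2)\<^sup>2"
      using sum_squares_bound[of "A * sqrt (real n)" "1 / 2"] by (simp add: power2_sum)
    also have "\<dots> = 2 * A\<^sup>2 * real n + 1 / 2" by (simp add: power_mult_distrib power2_eq_square)
    also have "\<dots> \<le> 2 * A\<^sup>2 * (3 * real m) + real m"
      using nm m by (intro add_mono mult_left_mono) auto
    finally have j2: "(real j)\<^sup>2 \<le> K * real m" by (simp add: K_def algebra_simps)
    have "(4 * real j)\<^sup>2 \<le> 16 * K * real m" using j2 by (simp add: power_mult_distrib)
    also have "\<dots> \<le> real m * real m" using m by (intro mult_right_mono) auto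
    finally have "(4 * real j)\<^sup>2 \<le> (real m)\<^sup>2" by (simp add: power2_eq_square)
    then have "4 * real j \<le> real m" by (rule power2_le_imp_le) simp
    then have j4: "4 * j \<le> m" by linarith
    have sym: "(2 * m) choose s = (2 * m) choose (m + j)"
    proof (cases "m \<le> s")
      case False
      then have "s = m - j" "j \<le> m" "2 * m - (m - j) = m + j" by (auto simp: j_def)
      then show ?thesis using binomial_symmetric[of "m - j" "2 * m"] by simp
    next
      case True
      then have "s = m + j" by (simp add: j_def)
      then show ?thesis by simp
    qed
    have "exp (- 4 * K) \<le> exp (- 4 * (real j)\<^sup>2 / real m)"
      using j2 m by (simp add: field_simps)
    moreover have "1 / (2 * sqrt (real n)) \<le> 1 / (2 * sqrt (real m))"
      using nm m by (intro divide_left_mono) auto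
    then have "1 / (2 * sqrt (real n)) \<le> real ((2 * m) choose m) / 4 ^ m"
      using central_binomial_lower[of m] by linarith
    ultimately have "exp (- 4 * K) * (1 / (2 * sqrt (real n))) \<le>
        exp (- 4 * (real j)\<^sup>2 / real m) * (real ((2 * m) choose m) / 4 ^ m)"
      by (intro mult_mono) auto
    also have "\<dots> \<le> real ((2 * m) choose s) / 4 ^ m"
      using divide_right_mono[OF binomial_off_centre[OF j4], of "4 ^ m"] by (simp add: sym)
    also have "\<dots> \<le> real (n choose s) / 4 ^ m"
      using nm by (cases s) (auto intro!: divide_right_mono)
    \<comment> \<open>\<open>4 ^ m\<close> is \<open>2 ^ n\<close> or half of it, according to the
      parity of \<open>n\<close>.\<close>
    also have "\<dots> \<le> 2 * (real (n choose s) / 2 ^ n)"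
      using nm by (auto simp: power_mult intro!: divide_right_mono)
    finally show ?thesis by simp
  qed
  then show ?thesis
    by (intro exI[of _ "exp (- 4 * K) / 4"] conjI exI[of _ "nat \<lceil>32 * K\<rceil> + 2"]) auto
qed

section \<open>Convolution with fair coins\<close>

definition coin_fps :: "real fps" where
  "coin_fps = fps_const (1 / 2) * (1 + fps_X)"

lemma coin_fps_nth: "coin_fps $ i = (if i \<le> 1 then 1 / 2 else 0)"
  by (cases i) (auto simp: coin_fps_def fps_X_def fps_one_nth)

lemma coin_fps_power_nth: "(coin_fps ^ n) $ k = real (n choose k) / 2 ^ n"
proof (induction n arbitrary: k)
  case (Suc n)
  show ?case
  proof (cases k)
    case 0
    then show ?thesis using Suc[of 0] by (simp add: coin_fps_nth)
  next
    case k: (Suc j)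
    have "(coin_fps ^ Suc n) $ k = (1 / 2) * ((coin_fps ^ n) $ k + (coin_fps ^ n) $ j)"
      by (simp add: coin_fps_def k mult.assoc distrib_right)
    then show ?thesis using Suc[of k] Suc[of j] by (simp add: k field_simps)
  qed
qed (auto simp: fps_one_nth binomial_eq_0_iff)

text \<open>Each coefficient of \<open>coin_fps ^ n\<close> is at most \<open>1 / sqrt n\<close>,
  and \<open>A ^ n\<close> has mass at most \<open>S ^ n\<close>. This applies to truncated laws,
  where \<open>S < 1\<close> yields the exponential gain.\<close>

lemma coin_mult_power_upper:
  fixes A :: "real fps"
  assumes nonneg: "\<And>i. 0 \<le> A $ i" and le: "\<And>N. (\<Sum>i\<le>N. A $ i) \<le> S" and n: "0 < n"
  shows "((coin_fps * A) ^ n) $ k \<le> S ^ n / sqrt (real n)"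
proof -
  have "((coin_fps * A) ^ n) $ k = (\<Sum>i\<le>k. (A ^ n) $ i * (coin_fps ^ n) $ (k - i))"
    unfolding power_mult_distrib by (subst mult.commute) (simp add: fps_mult_nth atMost_atLeast0)
  also have "\<dots> \<le> (\<Sum>i\<le>k. (A ^ n) $ i * (1 / sqrt (real n)))"
    unfolding coin_fps_power_nth
    by (intro sum_mono mult_left_mono binomial_upper n fps_power_nonneg nonneg)
  also have "\<dots> = (\<Sum>i\<le>k. (A ^ n) $ i) / sqrt (real n)" by (simp add: sum_divide_distrib)
  also have "\<dots> \<le> S ^ n / sqrt (real n)"
    by (intro divide_right_mono fps_power_partial_sum_le nonneg le) auto
  finally show ?thesis .
qed

text \<open>\<open>A ^ n\<close> puts at least half of its mass within \<open>R * sqrt n\<close> of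
  \<open>n / 2\<close>. From each such \<open>i\<close> the coins must supply
  \<open>n - 1 - i\<close>, which is again within order \<open>sqrt n\<close> of
  \<open>n / 2\<close> and has probability of order at least \<open>1 / sqrt n\<close>.\<close>

lemma coin_mult_power_lower:
  fixes A :: "real fps"
  assumes nonneg: "\<And>i. 0 \<le> A $ i" and s0: "(\<lambda>i. A $ i) sums 1"
    and s1: "(\<lambda>i. real i * A $ i) sums (1 / 2)" and s2: "(\<lambda>i. (real i)\<^sup>2 * A $ i) sums v"
  shows "\<exists>c>0. \<exists>N. \<forall>n\<ge>N. c / sqrt (real n) \<le> ((coin_fps * A) ^ n) $ (n - 1)"
proof -
  define R where "R = sqrt (2 * \<bar>v\<bar>) + 1"
  have R: "R \<ge> 1" by (simp add: R_def)
  have Rv: "2 * v \<le> R\<^sup>2"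
  proof -
    have "2 * v \<le> (sqrt (2 * \<bar>v\<bar>))\<^sup>2" by simp
    also have "\<dots> \<le> R\<^sup>2" unfolding R_def by (intro power_mono) auto
    finally show ?thesis .
  qed
  obtain c N where c: "c > 0" "\<And>n s. N \<le> n \<Longrightarrow> \<bar>real s - real n / 2\<bar> \<le> (R + 1) * sqrt (real n) \<Longrightarrow>
    c / sqrt (real n) \<le> real (n choose s) / 2 ^ n"
    using binomial_local_lower[of "R + 1"] R by auto
  have "c / 2 / sqrt (real n) \<le> ((coin_fps * A) ^ n) $ (n - 1)"
    if n: "N \<le> n" "nat \<lceil>16 * R\<^sup>2\<rceil> + 4 \<le> n" for n
  proof -
    have n16: "16 * R\<^sup>2 \<le> real n" and n4: "4 \<le> n" using n(2) by linarith+
    have "(4 * R)\<^sup>2 \<le> (sqrt (real n))\<^sup>2" using n16 by (simp add: power_mult_distrib)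
    then have "4 * R \<le> sqrt (real n)" by (rule power2_le_imp_le) simp
    then have "4 * R * sqrt (real n) \<le> sqrt (real n) * sqrt (real n)" by (intro mult_right_mono) auto
    \<comment> \<open>This keeps the window \<open>W\<close> below \<open>3 * n / 4\<close>, hence
      inside \<open>{..n - 1}\<close> once \<open>n \<ge> 4\<close>.\<close>
    then have Rn: "R * sqrt (real n) \<le> real n / 4" by simp
    define W where "W = {i. \<bar>real i - real n * (1 / 2)\<bar> < R * sqrt (real n)}"
    have Wsub: "W \<subseteq> {..n - 1}"
    proof
      fix i assume "i \<in> W"
      then have "real i \<le> real n / 2 + real n / 4" using Rn by (auto simp: W_def)
      then show "i \<in> {..n - 1}" using n4 by auto
    qed
    have half: "1 / 2 \<le> (\<Sum>i\<in>W. (A ^ n) $ i)"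
      by (rule fps_power_concentration[OF nonneg s0 s1 s2 _ Rv])
         (use n4 R finite_subset[OF Wsub] in \<open>auto simp: W_def\<close>)
    have s: "1 \<le> sqrt (real n)" using n4 by simp
    have "c / 2 / sqrt (real n) = (1 / 2) * (c / sqrt (real n))" by simp
    also have "\<dots> \<le> (\<Sum>i\<in>W. (A ^ n) $ i) * (c / sqrt (real n))"
      using half c(1) by (intro mult_right_mono) auto
    also have "\<dots> = (\<Sum>i\<in>W. (A ^ n) $ i * (c / sqrt (real n)))" by (rule sum_distrib_right)
    also have "\<dots> \<le> (\<Sum>i\<in>W. (A ^ n) $ i * (coin_fps ^ n) $ (n - 1 - i))"
    proof (intro sum_mono mult_left_mono fps_power_nonneg nonneg)
      fix i assume i: "i \<in> W"
      then have "i \<le> n - 1" using Wsub by auto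
      then have "real (n - 1 - i) = real n - 1 - real i" using n4 by (simp add: of_nat_diff)
      then have "\<bar>real (n - 1 - i) - real n / 2\<bar> \<le> (R + 1) * sqrt (real n)"
        using i s unfolding W_def distrib_right mem_Collect_eq by linarith
      then show "c / sqrt (real n) \<le> (coin_fps ^ n) $ (n - 1 - i)"
        unfolding coin_fps_power_nth by (rule c(2)[OF n(1)])
    qed
    also have "\<dots> \<le> (\<Sum>i\<le>n - 1. (A ^ n) $ i * (coin_fps ^ n) $ (n - 1 - i))"
      using Wsub nonneg by (intro sum_mono2 mult_nonneg_nonneg fps_power_nonneg) (auto simp: coin_fps_nth)
    also have "\<dots> = ((coin_fps * A) ^ n) $ (n - 1)"
      unfolding power_mult_distrib by (subst (2) mult.commute) (simp add: fps_mult_nth atMost_atLeast0)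
    finally show ?thesis .
  qed
  then show ?thesis
    using c(1) by (intro exI[of _ "c / 2"] conjI exI[of _ "max N (nat \<lceil>16 * R\<^sup>2\<rceil> + 4)"]) auto
qed

text \<open>The cycle lemma for forests: differentiating the power of the generating function
  replaces the cyclic rotations.\<close>

lemma forest_recursion_solution:
  fixes \<phi> :: "real fps" and F :: "nat \<Rightarrow> nat \<Rightarrow> real"
  assumes F0: "\<And>n. F 0 n = of_bool (n = 0)" and F1: "\<And>k. F (Suc k) 0 = 0"
    and FS: "\<And>k n. F (Suc k) (Suc n) = (\<Sum>j\<le>n. \<phi> $ j * F (j + k) n)"
    and n: "0 < n"
  shows "real n * F k n = real k * (if k \<le> n then (\<phi> ^ n) $ (n - k) else 0)"
  using n
proof (induction n arbitrary: k)
  case (Suc n)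
  show ?case
  proof (cases k)
    case 0
    then show ?thesis by (simp add: F0)
  next
    case k: (Suc l)
    show ?thesis
    proof (cases "n = 0")
      case True
      then show ?thesis using F0 F1 by (cases l) (auto simp: k FS)
    next
      case False
      have IH: "real n * F j n = real j * (if j \<le> n then (\<phi> ^ n) $ (n - j) else 0)" for j
        using Suc.IH False by blast
      have "real n * F k (Suc n) = (\<Sum>j\<le>n. \<phi> $ j * (real n * F (j + l) n))"
        by (simp add: k FS sum_distrib_left algebra_simps)
      also have "\<dots> = (\<Sum>j\<le>n. if j + l \<le> n then \<phi> $ j * real (j + l) * (\<phi> ^ n) $ (n - (j + l)) else 0)"
        unfolding IH by (intro sum.cong) auto
      also have "\<dots> = (\<Sum>j | j \<le> n \<and> j + l \<le> n. \<phi> $ j * real (j + l) * (\<phi> ^ n) $ (n - (j + l)))"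
        by (simp add: sum.If_cases Int_def)
      finally have eq: "real n * F k (Suc n) = \<dots>" .
      show ?thesis
      proof (cases "l \<le> n")
        case False
        then have e: "{j. j \<le> n \<and> j + l \<le> n} = {}" by auto
        have "real n * F k (Suc n) = 0" using eq unfolding e by simp
        then show ?thesis using False \<open>n \<noteq> 0\<close> by (simp add: k)
      next
        case True
        \<comment> \<open>Splitting the weight \<open>j + l\<close> in the sum gives
          \<open>l * P\<close> plus \<open>Q\<close>, the part weighted by \<open>j\<close>.\<close>
        define P where "P = (\<phi> ^ Suc n) $ (n - l)"
        define Q where "Q = (\<Sum>j\<le>n - l. (real j * \<phi> $ j) * (\<phi> ^ n) $ (n - l - j))"
        have "{j. j \<le> n \<and> j + l \<le> n} = {..n - l}" using True by auto
        then have "real n * F k (Suc n) = (\<Sum>j\<le>n - l. \<phi> $ j * real (j + l) * (\<phi> ^ n) $ (n - l - j))"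
          using eq by (simp add: diff_diff_left add.commute)
        also have "\<dots> = real l * P + Q"
          by (simp add: P_def Q_def fps_mult_nth atMost_atLeast0 sum_distrib_left
              sum.distrib[symmetric] algebra_simps)
        finally have 1: "real n * F k (Suc n) = real l * P + Q" .
        \<comment> \<open>The coefficient of this identity at \<open>n - l\<close> reads
          \<open>(n - l) * P = (n + 1) * Q\<close>, which eliminates \<open>Q\<close>.\<close>
        have "fps_X * fps_deriv (\<phi> ^ Suc n) = fps_const (real (Suc n)) * ((fps_X * fps_deriv \<phi>) * \<phi> ^ n)"
          by (simp add: fps_deriv_power mult_ac del: fps_const_add power_Suc)
        then have "(fps_X * fps_deriv (\<phi> ^ Suc n)) $ (n - l) =
            real (Suc n) * (((fps_X * fps_deriv \<phi>) * \<phi> ^ n) $ (n - l))"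
          by (simp only: fps_mult_left_const_nth)
        moreover have X: "(fps_X * fps_deriv f) $ i = real i * f $ i" for f :: "real fps" and i
          by (cases i) auto
        moreover have "((fps_X * fps_deriv \<phi>) * \<phi> ^ n) $ (n - l) = Q"
          unfolding fps_mult_nth[of "fps_X * fps_deriv \<phi>"] X Q_def atMost_atLeast0 ..
        ultimately have "real (n - l) * P = real (Suc n) * Q"
          unfolding P_def by (simp only: X)
        then have 2: "(real n - real l) * P = (real n + 1) * Q" using True by (simp add: of_nat_diff)
        have "real n * (real (Suc n) * F k (Suc n)) = (real n + 1) * (real n * F k (Suc n))"
          by (simp add: algebra_simps)
        also have "\<dots> = (real n + 1) * (real l * P) + (real n - real l) * P"
          unfolding 1 using 2 by (simp add: distrib_left)
        also have "\<dots> = real n * (real k * P)" by (simp add: k algebra_simps)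
        finally show ?thesis using \<open>n \<noteq> 0\<close> True by (simp add: P_def k)
      qed
    qed
  qed
qed simp

section \<open>Sizes of forests and spiders in trees\<close>

lemma sprob_cong: "(\<And>x. x \<in> set_spmf p \<Longrightarrow> P x \<longleftrightarrow> Q x) \<Longrightarrow> sprob p P = sprob p Q"
  by (intro antisym sprob_mono) auto

text \<open>Used with \<open>UNIV\<close>, which imposes nothing, and with \<open>{..<D}\<close>,
  which rules out every candidate for the centre of the spider.\<close>

definition degrees_in :: "nat set \<Rightarrow> ptree \<Rightarrow> bool" where
  "degrees_in A t \<longleftrightarrow> (\<forall>u. is_vertex u t \<longrightarrow> length (children (subtree_at u t)) \<in> A)"

lemma degrees_in_PNode: "degrees_in A (PNode ts) \<longleftrightarrow> length ts \<in> A \<and> (\<forall>t\<in>set ts. degrees_in A t)"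
  unfolding degrees_in_def all_vertex_PNode[of ts "\<lambda>s. length (children s) \<in> A"] by simp

definition forest_in :: "nat set \<Rightarrow> nat \<Rightarrow> ptree list \<Rightarrow> bool" where
  "forest_in A n ts \<longleftrightarrow> (\<forall>t\<in>set ts. degrees_in A t) \<and> (\<Sum>t\<leftarrow>ts. num_vertices t) = n"

lemma length_le_forest: "length ts \<le> (\<Sum>t\<leftarrow>ts. num_vertices t)"
proof (induction ts)
  case (Cons t ts)
  have "1 \<le> num_vertices t" by (cases t) (simp add: num_vertices_PNode)
  with Cons show ?case by simp
qed simp

definition offspring_fps :: "nat pmf \<Rightarrow> nat set \<Rightarrow> real fps" where
  "offspring_fps \<mu> A = Abs_fps (\<lambda>j. if j \<in> A then pmf \<mu> j else 0)"

text \<open>One step of exploring a forest: the first tree loses its root, and its \<open>j\<close>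
  root subtrees join the remaining \<open>k\<close> trees. Independence makes the new forest i.i.d.
  again, with one vertex fewer.\<close>

lemma iid_bienayme_Suc:
  "iid_spmf (Suc k) (bienayme \<mu>) = bind_spmf (spmf_of_pmf \<mu>)
     (\<lambda>j. map_spmf (\<lambda>ts. PNode (take j ts) # drop j ts) (iid_spmf (j + k) (bienayme \<mu>)))"
proof -
  let ?p = "bienayme \<mu>"
  have split: "map_spmf (\<lambda>ts. PNode (take j ts) # drop j ts) (iid_spmf (j + k) ?p) =
      bind_spmf (iid_spmf j ?p) (\<lambda>us. map_spmf ((#) (PNode us)) (iid_spmf k ?p))" for j
    unfolding iid_spmf_add map_spmf_bind_spmf o_def spmf.map_comp
    by (intro bind_spmf_cong refl map_spmf_cong) (auto dest: length_iid_spmf)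
  have "iid_spmf (Suc k) ?p = bind_spmf (bind_spmf (spmf_of_pmf \<mu>) (\<lambda>j. map_spmf PNode (iid_spmf j ?p)))
      (\<lambda>t. map_spmf ((#) t) (iid_spmf k ?p))"
    unfolding iid_spmf.simps by (subst bienayme.simps) (rule refl)
  also have "\<dots> = bind_spmf (spmf_of_pmf \<mu>)
     (\<lambda>j. map_spmf (\<lambda>ts. PNode (take j ts) # drop j ts) (iid_spmf (j + k) ?p))"
    unfolding split bind_spmf_assoc bind_map_spmf o_def ..
  finally show ?thesis .
qed

text \<open>The Otter-Dwass formula with restricted offspring numbers: the exploration step supplies
  the recursion that \<open>forest_recursion_solution\<close> solves.\<close>

lemma sprob_forest:
  assumes "0 < n"
  shows "real n * sprob (iid_spmf k (bienayme \<mu>)) (forest_in A n) =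
    real k * (if k \<le> n then (offspring_fps \<mu> A ^ n) $ (n - k) else 0)"
proof (rule forest_recursion_solution[OF _ _ _ assms])
  fix n k
  let ?p = "bienayme \<mu>"
  let ?F = "\<lambda>k n. sprob (iid_spmf k ?p) (forest_in A n)"
  show "?F 0 n = of_bool (n = 0)"
    unfolding sprob_iid_0 forest_in_def by (cases n) auto
  have zero: "?F k n = 0" if "n < k" for k n
  proof -
    have "?F k n = sprob (iid_spmf k ?p) (\<lambda>_. False)"
    proof (rule sprob_cong)
      fix ts assume "ts \<in> set_spmf (iid_spmf k ?p)"
      then have "length ts = k" by (rule length_iid_spmf)
      then show "forest_in A n ts \<longleftrightarrow> False"
        using length_le_forest[of ts] that by (auto simp: forest_in_def)
    qed
    then show ?thesis by simp
  qed
  show "?F (Suc k) 0 = 0" by (rule zero) simp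
  have "?F (Suc k) (Suc n) = (\<integral>j. of_bool (j \<in> A) * ?F (j + k) n \<partial>measure_pmf \<mu>)"
    unfolding iid_bienayme_Suc sprob_bind sprob_map measure_spmf_spmf_of_pmf
  proof (rule Bochner_Integration.integral_cong[OF refl])
    fix j
    have "sprob (iid_spmf (j + k) ?p) (\<lambda>ts. forest_in A (Suc n) (PNode (take j ts) # drop j ts)) =
        sprob (iid_spmf (j + k) ?p) (\<lambda>ts. j \<in> A \<and> forest_in A n ts)"
    proof (rule sprob_cong)
      fix ts assume "ts \<in> set_spmf (iid_spmf (j + k) ?p)"
      then have len: "length (take j ts) = j" using length_iid_spmf[of ts "j + k"] by simp
      have "(\<Sum>t\<leftarrow>ts. num_vertices t) = (\<Sum>t\<leftarrow>take j ts @ drop j ts. num_vertices t)" by simp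
      moreover have "set ts = set (take j ts) \<union> set (drop j ts)"
        by (metis append_take_drop_id set_append)
      ultimately show "forest_in A (Suc n) (PNode (take j ts) # drop j ts) \<longleftrightarrow> j \<in> A \<and> forest_in A n ts"
        unfolding forest_in_def
        by (auto simp: degrees_in_PNode num_vertices_PNode len simp del: append_take_drop_id length_take)
    qed
    then show "sprob (iid_spmf (j + k) ?p) (\<lambda>ts. forest_in A (Suc n) (PNode (take j ts) # drop j ts)) =
        of_bool (j \<in> A) * ?F (j + k) n" by simp
  qed
  \<comment> \<open>A forest of \<open>j + k\<close> trees has at least \<open>j + k\<close>
    vertices, so only \<open>j \<le> n\<close> contributes.\<close>
  also have "\<dots> = (\<Sum>j\<le>n. of_bool (j \<in> A) * ?F (j + k) n * pmf \<mu> j)"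
  proof (intro integral_measure_pmf_real)
    fix j assume "of_bool (j \<in> A) * ?F (j + k) n \<noteq> 0"
    then have "\<not> n < j + k" using zero[of n "j + k"] by auto
    then show "j \<in> {..n}" by simp
  qed simp
  also have "\<dots> = (\<Sum>j\<le>n. offspring_fps \<mu> A $ j * ?F (j + k) n)"
    by (intro sum.cong) (auto simp: offspring_fps_def)
  finally show "?F (Suc k) (Suc n) = \<dots>" .
qed

lemma sprob_size_degrees:
  assumes "0 < n"
  shows "sprob (bienayme \<mu>) (\<lambda>t. num_vertices t = n \<and> degrees_in A t) =
    (offspring_fps \<mu> A ^ n) $ (n - 1) / real n"
proof -
  have "sprob (iid_spmf (Suc 0) (bienayme \<mu>)) (forest_in A n) =
      (\<integral>t. indicat_real {t. num_vertices t = n \<and> degrees_in A t} t \<partial>measure_spmf (bienayme \<mu>))"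
    unfolding sprob_iid_Suc sprob_iid_0
    by (intro Bochner_Integration.integral_cong refl) (auto simp: forest_in_def indicator_def)
  then have "sprob (iid_spmf 1 (bienayme \<mu>)) (forest_in A n) =
      sprob (bienayme \<mu>) (\<lambda>t. num_vertices t = n \<and> degrees_in A t)" by simp
  with sprob_forest[OF assms, of 1 \<mu> A] assms show ?thesis by (simp add: field_simps)
qed

lemma sprob_size:
  assumes "0 < n"
  shows "sprob (bienayme \<mu>) (\<lambda>t. num_vertices t = n) = (offspring_fps \<mu> UNIV ^ n) $ (n - 1) / real n"
  using sprob_size_degrees[OF assms, of \<mu> UNIV] by (simp add: degrees_in_def)

section \<open>Embedded spiders\<close>

definition embeds :: "nat list set \<Rightarrow> ptree \<Rightarrow> bool" where
  "embeds V t \<longleftrightarrow> (\<exists>f. inj_on f V \<and> (\<forall>u\<in>V. is_vertex (f u) t) \<and>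
     (\<forall>u i. u @ [i] \<in> V \<longrightarrow> (\<exists>j. f (u @ [i]) = f u @ [j])))"

text \<open>The vertices of leg \<open>i\<close> are the words \<open>i\<close>, \<open>i 0\<close>, \<open>i 0 0\<close>, \<dots>; the centre is the empty word.\<close>

definition spider :: "nat set \<Rightarrow> (nat \<Rightarrow> nat) \<Rightarrow> nat list set" where
  "spider I l = insert [] ((\<lambda>(i, j). i # replicate j 0) ` (SIGMA i:I. {..<l i}))"

lemma Cons_in_spider:
  "i # w \<in> spider I l \<longleftrightarrow> i \<in> I \<and> length w < l i \<and> (\<forall>x\<in>set w. x = 0)"
proof
  assume R: "i \<in> I \<and> length w < l i \<and> (\<forall>x\<in>set w. x = 0)"
  then have w: "w = replicate (length w) 0" by (intro replicate_eqI) auto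
  have "i # w = (\<lambda>(i, j). i # replicate j 0) (i, length w)"
    unfolding prod.case by (subst w) (rule refl)
  moreover have "(i, length w) \<in> (SIGMA i:I. {..<l i})" using R by simp
  ultimately show "i # w \<in> spider I l" unfolding spider_def by (intro insertI2 image_eqI)
qed (auto simp: spider_def)

lemma finite_spider: "finite I \<Longrightarrow> finite (spider I l)"
  by (simp add: spider_def)

lemma card_spider: "finite I \<Longrightarrow> card (spider I l) = 1 + (\<Sum>i\<in>I. l i)"
proof -
  assume I: "finite I"
  have "inj_on (\<lambda>(i, j). i # replicate j (0 :: nat)) (SIGMA i:I. {..<l i})"
    by (auto simp: inj_on_def)
  then have "card ((\<lambda>(i, j). i # replicate j (0 :: nat)) ` (SIGMA i:I. {..<l i})) = (\<Sum>i\<in>I. l i)"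
    using I by (simp add: card_image)
  then show ?thesis unfolding spider_def using I by (subst card_insert_disjoint) auto
qed

lemma spider_closed: "u @ [a] \<in> spider I l \<Longrightarrow> u \<in> spider I l"
proof (cases u)
  case (Cons i w)
  assume "u @ [a] \<in> spider I l"
  then show ?thesis by (auto simp: Cons Cons_in_spider)
qed (simp add: spider_def)

text \<open>Choose in increasing order of the index: before index \<open>M\<close> at most
  \<open>M\<close> elements are taken, and \<open>C M\<close> has more.\<close>

lemma greedy_choice:
  assumes "\<And>i. i \<in> {m..<M} \<Longrightarrow> i < card (C i)" "\<And>i. finite (C i)"
  shows "\<exists>g. inj_on g {m..<M} \<and> (\<forall>i\<in>{m..<M}. g i \<in> C i)"
  using assms(1)
proof (induction M)
  case (Suc M)
  show ?case
  proof (cases "m \<le> M")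
    case True
    obtain g where g: "inj_on g {m..<M}" "\<forall>i\<in>{m..<M}. g i \<in> C i"
      using Suc by fastforce
    have "card (g ` {m..<M}) \<le> M" using card_image_le[of "{m..<M}" g] by simp
    also have "M < card (C M)" using Suc.prems True by simp
    finally have "\<not> C M \<subseteq> g ` {m..<M}" using card_mono[of "g ` {m..<M}" "C M"] by auto
    then obtain x where x: "x \<in> C M" "x \<notin> g ` {m..<M}" by blast
    have "{m..<Suc M} = insert M {m..<M}" using True by auto
    moreover have "inj_on (g(M := x)) (insert M {m..<M})"
      using g(1) x(2) by (auto simp: inj_on_def)
    moreover have "\<forall>i\<in>insert M {m..<M}. (g(M := x)) i \<in> C i" using g(2) x(1) by auto
    ultimately show ?thesis by metis
  qed simp
qed simp

text \<open>The centre goes to \<open>v\<close>. Distinct legs go to distinct children by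
  \<open>greedy_choice\<close>, and leg \<open>i\<close> follows the path from its child to a vertex
  \<open>w i\<close> at depth \<open>l i\<close> below that child, which exists by tallness.\<close>

lemma spider_embeds:
  assumes v: "is_vertex v t" and tall:
    "\<And>i. i \<in> {m..<M} \<Longrightarrow> i < length (filter (tall (l i)) (children (subtree_at v t)))"
  shows "embeds (spider {m..<M} l) t"
proof -
  let ?I = "{m..<M}"
  obtain ts where ts: "subtree_at v t = PNode ts" by (cases "subtree_at v t")
  define C where "C i = {j. j < length ts \<and> tall (l i) (ts ! j)}" for i
  have "i < card (C i)" if "i \<in> ?I" for i
    using tall[OF that] by (simp add: ts C_def length_filter_conv_card)
  moreover have "finite (C i)" for i by (simp add: C_def)
  ultimately obtain g where g: "inj_on g ?I" "\<And>i. i \<in> ?I \<Longrightarrow> g i \<in> C i"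
    using greedy_choice[of m M C] by blast
  have "\<forall>i\<in>?I. \<exists>u. is_vertex u (ts ! g i) \<and> length u = l i"
    using g(2) by (auto simp: C_def tall_def)
  then obtain w where w: "\<And>i. i \<in> ?I \<Longrightarrow> is_vertex (w i) (ts ! g i)" "\<And>i. i \<in> ?I \<Longrightarrow> length (w i) = l i"
    by metis
  define f where "f u = (case u of [] \<Rightarrow> v | i # x \<Rightarrow> v @ g i # take (length x) (w i))" for u
  have f: "f [] = v" "f (i # x) = v @ g i # take (length x) (w i)" for i x
    by (simp_all add: f_def)
  have "inj_on f (spider ?I l)"
  proof (rule inj_onI)
    fix a b assume a: "a \<in> spider ?I l" and b: "b \<in> spider ?I l" and eq: "f a = f b"
    show "a = b"
    proof (cases a; cases b)
      fix i x j y assume ab: "a = i # x" "b = j # y"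
      with a b have ij: "i \<in> ?I" "j \<in> ?I" "length x < l i" "length y < l j"
        and "\<forall>z\<in>set x. z = 0" "\<forall>z\<in>set y. z = 0"
        by (auto simp: Cons_in_spider)
      then have xy: "replicate (length x) 0 = x" "replicate (length y) 0 = y"
        by (metis replicate_eqI)+
      from eq have "g i = g j" and tk: "take (length x) (w i) = take (length y) (w j)"
        by (auto simp: ab f)
      with g(1) ij have "i = j" by (auto dest: inj_onD)
      moreover have "length x = length y"
        using arg_cong[OF tk, of length] ij w(2) \<open>i = j\<close> by simp
      ultimately show ?thesis using xy ab by metis
    qed (use eq in \<open>auto simp: f\<close>)
  qed
  moreover have "is_vertex (f a) t" if "a \<in> spider ?I l" for a
  proof (cases a)
    case (Cons i x)
    then have i: "i \<in> ?I" using that by (simp add: Cons_in_spider)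
    then have "is_vertex (take (length x) (w i)) (ts ! g i)"
      using w(1)[OF i] is_vertex_append[of "take (length x) (w i)" "drop (length x) (w i)"] by simp
    then show ?thesis using v g(2)[OF i] by (simp add: Cons f is_vertex_append ts C_def)
  qed (use v f in simp)
  moreover have "\<exists>j. f (u @ [a]) = f u @ [j]" if "u @ [a] \<in> spider ?I l" for u a
  proof (cases u)
    case (Cons i x)
    then have "i \<in> ?I" "length x < l i" using that by (auto simp: Cons_in_spider)
    then show ?thesis using w(2) by (simp add: Cons f take_Suc_conv_app_nth)
  qed (simp add: f)
  ultimately show ?thesis unfolding embeds_def by blast
qed

lemma LCS_ge_card_spider:
  assumes "finite I" "embeds (spider I l) t" "embeds (spider I l) t'"
  shows "card (spider I l) \<le> LCS t t'"
proof -
  obtain f g where f: "inj_on f (spider I l)" "\<And>u. u \<in> spider I l \<Longrightarrow> is_vertex (f u) t"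
      "\<And>u i. u @ [i] \<in> spider I l \<Longrightarrow> \<exists>j. f (u @ [i]) = f u @ [j]"
    and g: "inj_on g (spider I l)" "\<And>u. u \<in> spider I l \<Longrightarrow> is_vertex (g u) t'"
      "\<And>u i. u @ [i] \<in> spider I l \<Longrightarrow> \<exists>j. g (u @ [i]) = g u @ [j]"
    using assms(2,3) unfolding embeds_def by blast
  have "[] \<in> spider I l" by (simp add: spider_def)
  from LCS_ge_card[OF finite_spider[OF assms(1)] this spider_closed f g] show ?thesis .
qed

text \<open>Either all degrees are below \<open>D\<close>, an event computed by the cycle lemma, or
  a vertex of degree at least \<open>D\<close> fails to supply some leg. The second case is a union
  bound over legs and generations.\<close>

lemma sprob_not_embeds_le:
  assumes int1: "integrable (measure_pmf \<mu>) real" and mean: "(\<integral>k. real k \<partial>measure_pmf \<mu>) = 1"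
    and int2: "integrable (measure_pmf \<mu>) (\<lambda>k. (real k)\<^sup>2)"
    and C: "1 \<le> C" "2 * (\<integral>k. (real k)\<^sup>2 \<partial>measure_pmf \<mu>) \<le> real C"
    and D: "8 * C * M \<le> D" and n: "0 < n"
  shows "sprob (bienayme \<mu>) (\<lambda>t. num_vertices t = n \<and>
      \<not> embeds (spider {m..<M} (\<lambda>i. D div (8 * C * Suc i))) t)
    \<le> (offspring_fps \<mu> {..<D} ^ n) $ (n - 1) / real n + real n * (real M * exp (- real m))"
proof -
  let ?p = "bienayme \<mu>" and ?I = "{m..<M}"
  define l where "l i = D div (8 * C * Suc i)" for i
  let ?bad = "\<lambda>i t. num_vertices t = n \<and> (\<exists>v. is_vertex v t \<and> bad_root D (l i) i (subtree_at v t))"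
  have root: "sprob ?p (bad_root D (l i) i) \<le> exp (- real m)" if i: "i \<in> ?I" for i
  proof -
    \<comment> \<open>\<open>x\<close> is the lower bound for the probability of height
      \<open>l i\<close>. The length \<open>l i\<close> is chosen so that the mean number of tall
      subtrees among \<open>D\<close> is at least \<open>D * x \<ge> 4 * (i + 1)\<close>; the factor
      8 leaves room for \<open>l i + 1 \<le> 2 * D / (8 * C * (i + 1))\<close>.\<close>
    define x where "x = 1 / (real C * (real (l i) + 1))"
    have C1: "real C \<ge> 1" using C by simp
    have "8 * C * Suc i \<le> 8 * C * M" using i by (intro mult_le_mono2) auto
    then have CD: "8 * C * Suc i \<le> D" using D by linarith
    then have CDr: "8 * real C * (real i + 1) \<le> real D"
      by (metis of_nat_Suc of_nat_le_iff of_nat_mult of_nat_numeral add.commute)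
    have pos: "0 < 8 * real C * (real i + 1)" using C1 by simp
    have "real (l i) \<le> real D / real (8 * C * Suc i)"
      unfolding l_def by (rule of_nat_div_le_of_nat)
    then have "real (l i) \<le> real D / (8 * real C * (real i + 1))" by (simp add: algebra_simps)
    moreover have "1 \<le> real D / (8 * real C * (real i + 1))" using CDr pos by simp
    ultimately have "real (l i) + 1 \<le> 2 * (real D / (8 * real C * (real i + 1)))" by linarith
    also have "\<dots> = real D / (4 * real C * (real i + 1))" by simp
    finally have "(4 * (real i + 1)) * (real C * (real (l i) + 1)) \<le> real D"
      using C1 by (subst (asm) pos_le_divide_eq) (auto intro!: mult_pos_pos simp: mult_ac)
    then have "4 * (real i + 1) \<le> real D / (real C * (real (l i) + 1))"
      using C1 by (subst pos_le_divide_eq) auto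
    then have Dx: "4 * (real i + 1) \<le> real D * x" by (simp add: x_def)
    have "1 * 1 \<le> real C * (real (l i) + 1)" using C1 by (intro mult_mono) auto
    then have x: "0 \<le> x" "x \<le> 1" by (auto simp: x_def divide_simps)
    have "sprob ?p (\<lambda>t. \<not> tall (l i) t) \<le> 1 - x"
      unfolding x_def using C by (intro sprob_not_tall_le int1 mean int2) auto
    then have "sprob ?p (bad_root D (l i) i) \<le> 2 ^ i * ((1 + (1 - x)) / 2) ^ D"
      using x by (intro sprob_bad_root_le) auto
    \<comment> \<open>The exponent becomes \<open>i - D * x / 2\<close>, which is at most
      \<open>- i - 2\<close> and thus below \<open>- m\<close>.\<close>
    also have "\<dots> \<le> exp 1 ^ i * exp (- x / 2) ^ D"
    proof (intro mult_mono power_mono)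
      show "(2 :: real) \<le> exp 1" using exp_ge_add_one_self[of 1] by simp
      show "(1 + (1 - x)) / 2 \<le> exp (- x / 2)" using exp_ge_add_one_self[of "- x / 2"] by simp
    qed (use x in auto)
    also have "\<dots> = exp (real i - real D * x / 2)"
      by (simp add: exp_of_nat_mult[symmetric] exp_add[symmetric])
    also have "\<dots> \<le> exp (- real m)" using Dx i by simp
    finally show ?thesis .
  qed
  have "sprob ?p (\<lambda>t. num_vertices t = n \<and> \<not> embeds (spider ?I l) t) \<le>
      sprob ?p (\<lambda>t. (num_vertices t = n \<and> degrees_in {..<D} t) \<or> (\<exists>i\<in>?I. ?bad i t))"
  proof (rule sprob_mono)
    fix t assume t: "num_vertices t = n \<and> \<not> embeds (spider ?I l) t"
    show "(num_vertices t = n \<and> degrees_in {..<D} t) \<or> (\<exists>i\<in>?I. ?bad i t)"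
    proof (rule ccontr)
      assume neg: "\<not> ?thesis"
      then obtain v where v: "is_vertex v t" "D \<le> length (children (subtree_at v t))"
        using t by (auto simp: degrees_in_def not_less)
      have "i < length (filter (tall (l i)) (children (subtree_at v t)))" if "i \<in> ?I" for i
      proof (rule ccontr)
        assume "\<not> ?thesis"
        then have "bad_root D (l i) i (subtree_at v t)" using v by (simp add: bad_root_def)
        then show False using neg t that v(1) by blast
      qed
      then show False using spider_embeds[OF v(1)] t by blast
    qed
  qed
  also have "\<dots> \<le> sprob ?p (\<lambda>t. num_vertices t = n \<and> degrees_in {..<D} t) + sprob ?p (\<lambda>t. \<exists>i\<in>?I. ?bad i t)"
    by (rule sprob_disj_le)
  also have "sprob ?p (\<lambda>t. \<exists>i\<in>?I. ?bad i t) \<le> (\<Sum>i\<in>?I. sprob ?p (?bad i))"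
    by (rule sprob_bex_le) simp
  also have "\<dots> \<le> (\<Sum>i\<in>?I. real n * exp (- real m))"
  proof (rule sum_mono)
    fix i assume "i \<in> ?I"
    have "sprob ?p (?bad i) \<le> real n * sprob ?p (bad_root D (l i) i)"
      using mean by (intro sprob_ex_vertex_le int1) auto
    also have "\<dots> \<le> real n * exp (- real m)" using root[OF \<open>i \<in> ?I\<close>] by (intro mult_left_mono) auto
    finally show "sprob ?p (?bad i) \<le> real n * exp (- real m)" .
  qed
  also have "\<dots> \<le> real M * (real n * exp (- real m))"
    by (simp add: mult_right_mono)
  finally show ?thesis
    unfolding sprob_size_degrees[OF n] l_def by (simp add: mult_ac)
qed

section \<open>A heavy-tailed critical offspring distribution\<close>

text \<open>Mean value theorem; the derivative is smallest in absolute value at the right endpoint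
  \<open>b\<close>.\<close>

lemma powr_neg_diff_ge:
  fixes a b \<epsilon> :: real
  assumes "0 < a" "a \<le> b" "0 < \<epsilon>"
  shows "\<epsilon> * (b - a) * b powr (- \<epsilon> - 1) \<le> a powr (- \<epsilon>) - b powr (- \<epsilon>)"
proof (cases "a = b")
  case False
  then have ab: "a < b" using assms by simp
  have "\<exists>z. a < z \<and> z < b \<and> b powr (- \<epsilon>) - a powr (- \<epsilon>) = (b - a) * ((- \<epsilon>) * z powr (- \<epsilon> - 1))"
    using assms(1) by (intro MVT2[OF ab]) (auto intro!: derivative_eq_intros)
  then obtain z where z: "a < z" "z < b"
      "b powr (- \<epsilon>) - a powr (- \<epsilon>) = (b - a) * ((- \<epsilon>) * z powr (- \<epsilon> - 1))" by blast
  have "b powr (- \<epsilon> - 1) \<le> z powr (- \<epsilon> - 1)"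
    using z assms by (intro powr_mono2') auto
  then have "(\<epsilon> * (b - a)) * b powr (- \<epsilon> - 1) \<le> (\<epsilon> * (b - a)) * z powr (- \<epsilon> - 1)"
    using ab assms by (intro mult_left_mono) auto
  then show ?thesis using z(3) by (simp add: algebra_simps)
qed simp

lemma ex_heavy_tail:
  fixes \<epsilon> :: real
  assumes \<epsilon>: "0 < \<epsilon>"
  shows "\<exists>h c. (\<forall>k. 0 \<le> h k) \<and> 0 < h 0 \<and> h sums 1 \<and> (\<lambda>k. real k * h k) sums (1 / 2) \<and>
    summable (\<lambda>k. (real k)\<^sup>2 * h k) \<and> 0 < c \<and>
    (\<forall>D\<ge>1. (\<Sum>k<D. h k) \<le> 1 - c / ((real D)\<^sup>2 * ln (2 * real D + 1) powr (1 + \<epsilon>)))"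
proof -
  \<comment> \<open>With weights \<open>(f k - f (k + 1)) / k\<^sup>2\<close> the second moment telescopes.\<close>
  define f where "f k = ln (real k + 1) powr (- \<epsilon>)" for k :: nat
  define b where "b k = (f k - f (Suc k)) / (real k)\<^sup>2" for k
  \<comment> \<open>Monotonicity fails at 0, since \<open>ln 1 = 0\<close> makes
    \<open>f 0 = 0\<close>; this is harmless because division by zero gives
    \<open>b 0 = 0\<close>.\<close>
  have dec: "f (Suc k) \<le> f k" if "k \<ge> 1" for k
    unfolding f_def using that \<epsilon> by (intro powr_mono2') auto
  have b0: "0 \<le> b k" for k
    using dec[of k] by (cases "k = 0") (auto simp: b_def)
  have "(f \<longlongrightarrow> 0) sequentially"
    unfolding f_def using \<epsilon> by real_asymp
  then have "summable (\<lambda>k. f (Suc k) - f (Suc (Suc k)))"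
    by (intro telescope_summable'[where c = 0]) (rule LIMSEQ_Suc)
  also have "(\<lambda>k. f (Suc k) - f (Suc (Suc k))) = (\<lambda>k. (real (Suc k))\<^sup>2 * b (Suc k))"
    by (auto simp: b_def)
  finally have sum2: "summable (\<lambda>k. (real k)\<^sup>2 * b k)"
    by (simp only: summable_Suc_iff[of "\<lambda>k. (real k)\<^sup>2 * b k"])
  have le2: "real k * b k \<le> (real k)\<^sup>2 * b k" for k
  proof (cases "k = 0")
    case False
    then have "real k * 1 \<le> real k * real k" by (intro mult_left_mono) auto
    then show ?thesis using b0[of k] by (simp add: power2_eq_square mult_right_mono)
  qed simp
  have le1: "b k \<le> real k * b k" for k
  proof (cases "k = 0")
    case False
    then have "1 * b k \<le> real k * b k" using b0[of k] by (intro mult_right_mono) auto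
    then show ?thesis by simp
  qed (simp add: b_def)
  have sum1: "summable (\<lambda>k. real k * b k)"
    by (rule summable_comparison_test'[OF sum2, of 0]) (use b0 le2 in auto)
  have sum0: "summable b"
    by (rule summable_comparison_test'[OF sum1, of 0]) (use b0 le1 in auto)
  define s where "s = (\<Sum>k. real k * b k)"
  have "f 2 < f 1" unfolding f_def using \<epsilon> by (intro powr_less_mono2_neg) auto
  then have "0 < real 1 * b 1" by (simp add: b_def numeral_2_eq_2)
  then have s: "0 < s"
    unfolding s_def by (intro suminf_pos2[OF sum1, of 1]) (use b0 in auto)
  define T where "T = (\<Sum>k. b k)"
  have T: "T \<le> s" unfolding T_def s_def by (rule suminf_le[OF le1 sum0 sum1])
  \<comment> \<open>The scaling makes the mean \<open>1 / 2\<close>. As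
    \<open>b k \<le> k * b k\<close>, the mass used is at most \<open>1 / 2\<close>, and the rest is
    placed at 0, so \<open>h 0\<close> is positive.\<close>
  define a where "a = 1 / (2 * s)"
  have a: "0 < a" using s by (simp add: a_def)
  have aT: "a * T \<le> 1 / 2" using T s by (simp add: a_def field_simps)
  define h where "h k = (if k = 0 then 1 - a * T else a * b k)" for k
  have "(\<lambda>k. a * b k + (if k = 0 then 1 - a * T else 0)) sums (a * T + (1 - a * T))"
    using sum0 by (intro sums_add sums_mult sums_single) (simp add: T_def summable_sums)
  also have "(\<lambda>k. a * b k + (if k = 0 then 1 - a * T else 0)) = h"
    by (auto simp: h_def b_def)
  finally have h1: "h sums 1" by simp
  have "(\<lambda>k. a * (real k * b k)) sums (a * s)"
    using sum1 by (intro sums_mult) (simp add: s_def summable_sums)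
  also have "(\<lambda>k. a * (real k * b k)) = (\<lambda>k. real k * h k)" by (auto simp: h_def)
  also have "a * s = 1 / 2" using s by (simp add: a_def)
  finally have hm: "(\<lambda>k. real k * h k) sums (1 / 2)" .
  have "summable (\<lambda>k. a * ((real k)\<^sup>2 * b k))" by (intro summable_mult sum2)
  also have "(\<lambda>k. a * ((real k)\<^sup>2 * b k)) = (\<lambda>k. (real k)\<^sup>2 * h k)" by (auto simp: h_def)
  finally have h2: "summable (\<lambda>k. (real k)\<^sup>2 * h k)" .
  have h0: "0 \<le> h k" for k using a b0[of k] aT by (simp add: h_def)
  \<comment> \<open>The tail is bounded below by its part on \<open>{D..<2 * D}\<close>, where
    \<open>k^2 \<le> 4 * D^2\<close> explains the 4. There \<open>f\<close> telescopes, and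
    \<open>powr_neg_diff_ge\<close> yields \<open>\<epsilon>\<close> times a difference of
    logarithms that is at least \<open>ln (3 / 2)\<close>.\<close>
  define c where "c = a * \<epsilon> * ln (3 / 2) / 4"
  have c: "0 < c" using a \<epsilon> by (simp add: c_def)
  have tail: "(\<Sum>k<D. h k) \<le> 1 - c / ((real D)\<^sup>2 * ln (2 * real D + 1) powr (1 + \<epsilon>))" if D: "1 \<le> D" for D
  proof -
    define x y where "x = ln (real D + 1)" and "y = ln (2 * real D + 1)"
    have x: "0 < x" using D by (simp add: x_def)
    have "ln (3 / 2) \<le> ln ((2 * real D + 1) / (real D + 1))"
      using D by (subst ln_le_cancel_iff) (auto simp: field_simps)
    also have "\<dots> = y - x" using D by (simp add: x_def y_def ln_div)
    finally have yx: "ln (3 / 2) \<le> y - x" .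
    then have xy: "x \<le> y" using ln_ge_zero[of "3 / 2"] by linarith
    have e: "- \<epsilon> - 1 = - (1 + \<epsilon>)" by simp
    have "c / ((real D)\<^sup>2 * y powr (1 + \<epsilon>)) = a / (2 * real D)\<^sup>2 * (\<epsilon> * ln (3 / 2) * y powr (- \<epsilon> - 1))"
      unfolding c_def e powr_minus_divide by (simp add: power_mult_distrib)
    also have "\<dots> \<le> a / (2 * real D)\<^sup>2 * (\<epsilon> * (y - x) * y powr (- \<epsilon> - 1))"
      using a \<epsilon> yx by (intro mult_left_mono mult_right_mono) auto
    also have "\<dots> \<le> a / (2 * real D)\<^sup>2 * (x powr (- \<epsilon>) - y powr (- \<epsilon>))"
      using a powr_neg_diff_ge[OF x xy \<epsilon>] by (intro mult_left_mono) auto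
    also have "x powr (- \<epsilon>) - y powr (- \<epsilon>) = f D - f (2 * D)" by (simp add: f_def x_def y_def)
    also have "f D - f (2 * D) = (\<Sum>k=D..<2 * D. f k - f (Suc k))"
      using sum_Suc_diff'[of D "2 * D" "\<lambda>k. - f k"] by (simp add: algebra_simps)
    also have "a / (2 * real D)\<^sup>2 * \<dots> = (\<Sum>k=D..<2 * D. a * ((f k - f (Suc k)) / (2 * real D)\<^sup>2))"
      by (simp add: sum_distrib_left)
    also have "\<dots> \<le> (\<Sum>k=D..<2 * D. h k)"
    proof (rule sum_mono)
      fix k assume k: "k \<in> {D..<2 * D}"
      have "(real k)\<^sup>2 \<le> (2 * real D)\<^sup>2" using k by (intro power_mono) auto
      moreover have "0 < (real k)\<^sup>2" using k D by simp
      moreover have "0 \<le> f k - f (Suc k)" using dec[of k] k D by auto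
      ultimately have "(f k - f (Suc k)) / (2 * real D)\<^sup>2 \<le> b k"
        using D unfolding b_def by (intro divide_left_mono mult_pos_pos) auto
      then have "a * ((f k - f (Suc k)) / (2 * real D)\<^sup>2) \<le> a * b k"
        using a by (intro mult_left_mono) auto
      then show "a * ((f k - f (Suc k)) / (2 * real D)\<^sup>2) \<le> h k"
        using k D by (simp add: h_def)
    qed
    also have "\<dots> = (\<Sum>k<2 * D. h k) - (\<Sum>k<D. h k)"
      using sum.atLeastLessThan_concat[of 0 D "2 * D" h, unfolded atLeast0LessThan] by linarith
    also have "(\<Sum>k<2 * D. h k) \<le> 1"
      using sum_le_suminf[of h "{..<2 * D}"] h0 sums_summable[OF h1] sums_unique[OF h1] by auto
    finally show ?thesis by (simp add: y_def)
  qed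
  show ?thesis
    using h0 h1 hm h2 c tail aT by (intro exI[of _ h] exI[of _ c]) (auto simp: h_def)
qed

section \<open>The critical law of a coin plus a heavy-tailed variable\<close>

lemma coin_fps_mult_nth:
  "(coin_fps * Abs_fps h) $ k = (h k + (if k = 0 then 0 else h (k - 1))) / 2"
  by (cases k) (auto simp: coin_fps_def distrib_right mult.assoc)

lemma sums_shift:
  fixes f :: "nat \<Rightarrow> real"
  assumes "(\<lambda>k. f (Suc k)) sums x" "f 0 = 0"
  shows "f sums x"
  using sums_Suc[OF assms(1)] assms(2) by simp

lemma coin_offspring_moments:
  fixes h :: "nat \<Rightarrow> real"
  assumes h1: "h sums 1" and hm: "(\<lambda>k. real k * h k) sums (1 / 2)"
    and h2: "summable (\<lambda>k. (real k)\<^sup>2 * h k)"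
  defines "\<phi> \<equiv> coin_fps * Abs_fps h"
  shows "(\<lambda>k. \<phi> $ k) sums 1" "(\<lambda>k. real k * \<phi> $ k) sums 1" "summable (\<lambda>k. (real k)\<^sup>2 * \<phi> $ k)"
proof -
  let ?g = "\<lambda>k. if k = 0 then 0 else h (k - 1)"
  have \<phi>: "\<phi> $ k = (h k + ?g k) / 2" for k unfolding \<phi>_def coin_fps_mult_nth ..
  have g: "?g sums 1" by (rule sums_shift) (use h1 in auto)
  have "(\<lambda>k. (h k + ?g k) / 2) sums ((1 + 1) / 2)" by (intro sums_divide sums_add h1 g)
  then show "(\<lambda>k. \<phi> $ k) sums 1" by (simp add: \<phi>)
  have "(\<lambda>k. real (Suc k) * h k) sums (1 / 2 + 1)"
    using sums_add[OF hm h1] by (simp add: algebra_simps)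
  then have gm: "(\<lambda>k. real k * ?g k) sums (1 / 2 + 1)"     by (intro sums_shift[of "\<lambda>k. real k * ?g k"]) simp_all
  have "(\<lambda>k. (real k * h k + real k * ?g k) / 2) sums ((1 / 2 + (1 / 2 + 1)) / 2)"
    by (intro sums_divide sums_add hm gm)
  then show "(\<lambda>k. real k * \<phi> $ k) sums 1" by (simp add: \<phi> algebra_simps)
  have "summable (\<lambda>k. (real k)\<^sup>2 * h k + 2 * (real k * h k) + h k)"
    using h1 hm by (intro summable_add summable_mult h2) (auto simp: sums_iff)
  also have "(\<lambda>k. (real k)\<^sup>2 * h k + 2 * (real k * h k) + h k) = (\<lambda>k. (real (Suc k))\<^sup>2 * ?g (Suc k))"
    by (auto simp: power2_eq_square algebra_simps)
  finally have "summable (\<lambda>k. (real k)\<^sup>2 * ?g k)"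
    by (simp only: summable_Suc_iff[of "\<lambda>k. (real k)\<^sup>2 * ?g k"])
  then have "summable (\<lambda>k. ((real k)\<^sup>2 * h k + (real k)\<^sup>2 * ?g k) / 2)"
    by (intro summable_divide summable_add h2)
  then show "summable (\<lambda>k. (real k)\<^sup>2 * \<phi> $ k)" by (simp add: \<phi> algebra_simps)
qed

lemma ex_pmf_of_sums:
  fixes f :: "nat \<Rightarrow> real"
  assumes "\<And>k. 0 \<le> f k" "f sums 1"
  shows "\<exists>\<mu>. \<forall>k. pmf \<mu> k = f k"
proof -
  have "(\<integral>\<^sup>+ k. ennreal (f k) \<partial>count_space UNIV) = 1"
    unfolding nn_integral_count_space_nat using suminf_ennreal_eq[OF assms] by simp
  then have "pmf (embed_pmf f) k = f k" for k using assms(1) by (intro pmf_embed_pmf)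
  then show ?thesis by blast
qed

lemma pmf_integral_of_sums:
  fixes \<mu> :: "nat pmf" and f :: "nat \<Rightarrow> real"
  assumes "\<And>k. 0 \<le> f k" "(\<lambda>k. f k * pmf \<mu> k) sums x"
  shows "integrable (measure_pmf \<mu>) f" "(\<integral>k. f k \<partial>measure_pmf \<mu>) = x"
proof -
  have int: "integrable (count_space UNIV) (\<lambda>k. pmf \<mu> k * f k)"
    using assms by (simp add: integrable_count_space_nat_iff sums_iff abs_mult mult.commute)
  show "integrable (measure_pmf \<mu>) f"
    unfolding measure_pmf_eq_density using int by (subst integrable_density) auto
  show "(\<integral>k. f k \<partial>measure_pmf \<mu>) = x"
    unfolding measure_pmf_eq_density using int assms(2)
    by (subst integral_density) (auto simp: integral_count_space_nat sums_iff mult.commute)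
qed

lemma sprob_pair: "sprob (pair_spmf p q) (\<lambda>(x, y). P x \<and> Q y) = sprob p P * sprob q Q"
proof -
  have "sprob (pair_spmf p q) (\<lambda>(x, y). P x \<and> Q y) = (\<integral>x. indicat_real {x. P x} x * sprob q Q \<partial>measure_spmf p)"
    unfolding pair_spmf_alt_def sprob_bind
  proof (intro Bochner_Integration.integral_cong refl)
    fix x
    have "(\<integral>y. sprob (return_spmf (x, y)) (\<lambda>(x, y). P x \<and> Q y) \<partial>measure_spmf q) =
        (\<integral>y. indicat_real {x. P x} x * indicat_real {y. Q y} y \<partial>measure_spmf q)"
      by (intro Bochner_Integration.integral_cong refl)
         (auto simp: measure_spmf_return_spmf measure_return split: split_indicator)
    then show "(\<integral>y. sprob (return_spmf (x, y)) (\<lambda>(x, y). P x \<and> Q y) \<partial>measure_spmf q) =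
        indicat_real {x. P x} x * sprob q Q" by simp
  qed
  then show ?thesis by simp
qed

text \<open>For \<open>A\<close> of mass zero both sides are 0.\<close>

lemma sprob_cond_spmf:
  "sprob (cond_spmf p A) Q = sprob p (\<lambda>x. x \<in> A \<and> Q x) / measure (measure_spmf p) A"
proof -
  let ?m = "measure (measure_spmf p) A"
  have "emeasure (measure_spmf (cond_spmf p A)) {x. Q x} =
      (\<integral>\<^sup>+ x. ennreal (spmf (cond_spmf p A) x) * indicator {x. Q x} x \<partial>count_space UNIV)"
    by (subst nn_integral_measure_spmf[symmetric]) simp
  also have "\<dots> = (\<integral>\<^sup>+ x. ennreal (1 / ?m) * (ennreal (spmf p x) * indicator {x. x \<in> A \<and> Q x} x) \<partial>count_space UNIV)"
    by (intro nn_integral_cong) (auto simp: ennreal_mult[symmetric] split: split_indicator)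
  also have "\<dots> = ennreal (1 / ?m) * emeasure (measure_spmf p) {x. x \<in> A \<and> Q x}"
    by (subst nn_integral_cmult) (simp_all add: nn_integral_measure_spmf[symmetric])
  finally show ?thesis
    by (simp add: measure_spmf.emeasure_eq_measure ennreal_mult[symmetric])
qed

lemma ln_le_harmonic_sum:
  "m \<le> M \<Longrightarrow> ln (real M + 1) - ln (real m + 1) \<le> (\<Sum>i=m..<M. 1 / (real i + 1))"
proof (induction M rule: dec_induct)
  case (step M)
  have "ln (real M + 2) - ln (real M + 1) = ln (1 + 1 / (real M + 1))"
  proof -
    have "1 + 1 / (real M + 1) = (real M + 2) / (real M + 1)" by (simp add: field_simps)
    then show ?thesis by (simp add: ln_div)
  qed
  also have "\<dots> \<le> 1 / (real M + 1)" by (intro ln_add_one_self_le_self) auto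
  finally show ?case using step by (simp add: add_ac)
qed simp

text \<open>The leg lengths form a piece of a harmonic series; rounding down loses at most 1 per
  leg, altogether at most \<open>M\<close>.\<close>

lemma card_spider_ge:
  assumes "0 < K" "m \<le> M"
  shows "real D / real K * (ln (real M + 1) - ln (real m + 1)) - real M
    \<le> real (card (spider {m..<M} (\<lambda>i. D div (K * Suc i))))"
proof -
  have "real D / real K * (ln (real M + 1) - ln (real m + 1)) - real M
      \<le> real D / real K * (\<Sum>i=m..<M. 1 / (real i + 1)) - (\<Sum>i=m..<M. 1)"
    using assms by (intro diff_mono mult_left_mono ln_le_harmonic_sum) auto
  also have "\<dots> = (\<Sum>i=m..<M. real D / (real K * (real i + 1)) - 1)"
    by (simp add: sum_distrib_left sum_subtractf)
  also have "\<dots> \<le> (\<Sum>i=m..<M. real (D div (K * Suc i)))"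
  proof (rule sum_mono)
    fix i
    have "real D / real (K * Suc i) - 1 \<le> real (D div (K * Suc i))"
      unfolding of_int_of_nat_eq[symmetric, where 'a = real] floor_divide_of_nat_eq[symmetric, where 'a = real]
      by linarith
    then show "real D / (real K * (real i + 1)) - 1 \<le> real (D div (K * Suc i))"
      by (simp add: algebra_simps)
  qed
  also have "\<dots> \<le> real (card (spider {m..<M} (\<lambda>i. D div (K * Suc i))))"
    by (simp add: card_spider)
  finally show ?thesis .
qed

text \<open>If coin plus \<open>H\<close> is below \<open>D\<close>, then so is \<open>H\<close>:
  the truncated law lies coefficientwise below the coin convolved with the truncation of
  \<open>h\<close>.\<close>

lemma offspring_power_upper:
  fixes h :: "nat \<Rightarrow> real"
  assumes h0: "\<And>k. 0 \<le> h k" and \<mu>: "\<And>k. pmf \<mu> k = (coin_fps * Abs_fps h) $ k" and n: "0 < n"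
  shows "(offspring_fps \<mu> {..<D} ^ n) $ k \<le> (\<Sum>k<D. h k) ^ n / sqrt (real n)"
proof -
  define A where "A = Abs_fps (\<lambda>k. if k < D then h k else 0)"
  have A0: "0 \<le> A $ i" for i using h0 by (simp add: A_def)
  have "offspring_fps \<mu> {..<D} $ i \<le> (coin_fps * A) $ i" for i
    using h0 unfolding offspring_fps_def A_def coin_fps_mult_nth fps_nth_Abs_fps \<mu>
    by (auto intro: add_nonneg_nonneg)
  then have "(offspring_fps \<mu> {..<D} ^ n) $ k \<le> ((coin_fps * A) ^ n) $ k"
    by (intro fps_power_mono) (auto simp: offspring_fps_def)
  also have "\<dots> \<le> (\<Sum>k<D. h k) ^ n / sqrt (real n)"
  proof (rule coin_mult_power_upper[OF A0 _ n])
    fix N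
    have "(\<Sum>i\<le>N. A $ i) = (\<Sum>i\<in>{..N} \<inter> {..<D}. h i)"
      by (simp add: A_def sum.inter_restrict)
    also have "\<dots> \<le> (\<Sum>k<D. h k)" using h0 by (intro sum_mono2) auto
    finally show "(\<Sum>i\<le>N. A $ i) \<le> (\<Sum>k<D. h k)" .
  qed
  finally show ?thesis .
qed

section \<open>Asymptotics\<close>

definition star_degree :: "real \<Rightarrow> nat \<Rightarrow> nat" where
  "star_degree \<beta> n = nat \<lceil>sqrt (real n) * ln (real n) powr (\<beta> - 1)\<rceil>"

text \<open>With \<open>m = leg_start n\<close>, legs run over \<open>m \<le> i < m^2\<close>. A
  power of \<open>n\<close> makes \<open>exp (- m)\<close> beat every polynomial factor, while the
  logarithms of the two ends still differ by order \<open>ln n\<close>.\<close>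

definition leg_start :: "nat \<Rightarrow> nat" where
  "leg_start n = nat \<lfloor>real n powr (1 / 8)\<rfloor>"

lemma leg_start_bounds:
  "real (leg_start n) \<le> real n powr (1 / 8)" "real n powr (1 / 8) - 1 \<le> real (leg_start n)"
  by (simp_all add: leg_start_def)

text \<open>A lower bound for the star degree that is free of \<beta>, convenient for asymptotic
  comparisons.\<close>

lemma ln_powr_ge_inverse:
  assumes "0 \<le> \<beta>" "1 \<le> ln (real n)"
  shows "sqrt (real n) / ln (real n) \<le> sqrt (real n) * ln (real n) powr (\<beta> - 1)"
proof -
  have "ln (real n) powr (- 1) \<le> ln (real n) powr (\<beta> - 1)"
    using assms by (intro powr_mono) auto
  then have "sqrt (real n) * ln (real n) powr (- 1) \<le> sqrt (real n) * ln (real n) powr (\<beta> - 1)"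
    by (intro mult_left_mono) auto
  then show ?thesis using assms by (simp add: powr_minus_divide)
qed

lemma star_degree_ge: "sqrt (real n) * ln (real n) powr (\<beta> - 1) \<le> real (star_degree \<beta> n)"
  unfolding star_degree_def by linarith

lemma eventually_ln_ge_1: "eventually (\<lambda>n. 1 \<le> ln (real n)) sequentially"
  by real_asymp

lemma eventually_legs_le_star_degree:
  assumes "0 \<le> \<beta>" "1 \<le> C"
  shows "eventually (\<lambda>n. 8 * C * (leg_start n)\<^sup>2 \<le> star_degree \<beta> n) sequentially"
proof -
  have "0 < real C" using assms by simp
  then have "eventually (\<lambda>n. 8 * real C * (real n powr (1 / 8))\<^sup>2 \<le> sqrt (real n) / ln (real n)) sequentially"
    by real_asymp
  with eventually_ln_ge_1 show ?thesis
  proof eventually_elim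
    case (elim n)
    have "(real (leg_start n))\<^sup>2 \<le> (real n powr (1 / 8))\<^sup>2"
      using leg_start_bounds(1) by (intro power_mono) auto
    then have "8 * real C * (real (leg_start n))\<^sup>2 \<le> 8 * real C * (real n powr (1 / 8))\<^sup>2"
      by (intro mult_left_mono) auto
    also have "\<dots> \<le> real (star_degree \<beta> n)"
      using elim(2) ln_powr_ge_inverse[OF assms(1) elim(1)] star_degree_ge[of n \<beta>] by linarith
    finally have "real (8 * C * (leg_start n)\<^sup>2) \<le> real (star_degree \<beta> n)" by simp
    then show ?case by (simp only: of_nat_le_iff)
  qed
qed

text \<open>The harmonic sum gives about \<open>D * ln n\<close>, up to constants, that is
  \<open>sqrt n * (ln n) powr \<beta>\<close>. The gap between \<gamma> and \<beta> absorbs the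
  constants and the rounding loss.\<close>

lemma eventually_spider_large:
  assumes \<gamma>: "0 \<le> \<gamma>" "\<gamma> < \<beta>" and C: "1 \<le> C"
  shows "eventually (\<lambda>n. sqrt (real n) * ln (real n) powr \<gamma> \<le>
    real (card (spider {leg_start n..<(leg_start n)\<^sup>2} (\<lambda>i. star_degree \<beta> n div (8 * C * Suc i))))) sequentially"
proof -
  \<comment> \<open>The difference is asymptotically \<open>ln n / 8\<close>; the weaker constant 16
    leaves slack.\<close>
  have E1: "eventually (\<lambda>n. ln (real n) / 16 \<le>
      ln ((real n powr (1 / 8) - 1)\<^sup>2 + 1) - ln (real n powr (1 / 8) + 1)) sequentially"
    by real_asymp
  have E2: "eventually (\<lambda>n. (real n powr (1 / 8))\<^sup>2 \<le> sqrt (real n)) sequentially"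
    by real_asymp
  have "0 < \<beta> - \<gamma>" using \<gamma> by simp
  then have "filterlim (\<lambda>n. ln (real n) powr (\<beta> - \<gamma>)) at_top sequentially"
    by real_asymp
  then have E3: "eventually (\<lambda>n. 256 * real C \<le> ln (real n) powr (\<beta> - \<gamma>)) sequentially"
    by (simp add: filterlim_at_top)
  have E5: "eventually (\<lambda>n. 1 \<le> real n powr (1 / 8) - 1) sequentially"
    by real_asymp
  from E1 E2 E3 eventually_ln_ge_1 E5 show ?thesis
  proof eventually_elim
    case (elim n)
    define m D L x where "m = leg_start n" and "D = star_degree \<beta> n"
      and "L = ln (real n)" and "x = real n powr (1 / 8)"
    have L: "1 \<le> L" using elim by (simp add: L_def)
    have m: "real m \<le> x" "x - 1 \<le> real m"
      using leg_start_bounds[of n] by (auto simp: m_def x_def)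
    have x: "1 \<le> x - 1" using elim by (simp add: x_def)
    have "1 \<le> real m" using x m by linarith
    then have mm: "m \<le> m\<^sup>2" by (simp add: power2_eq_square)
    have m2: "(x - 1)\<^sup>2 \<le> (real m)\<^sup>2" "(real m)\<^sup>2 \<le> x\<^sup>2"
      using m x by (auto intro!: power_mono)
    have "L / 16 \<le> ln ((x - 1)\<^sup>2 + 1) - ln (x + 1)" using elim by (simp add: L_def x_def)
    also have "\<dots> \<le> ln (real (m\<^sup>2) + 1) - ln (real m + 1)"
      using m m2 x by (intro diff_mono) (auto simp: add_nonneg_pos)
    finally have logs: "L / 16 \<le> ln (real (m\<^sup>2) + 1) - ln (real m + 1)" .
    \<comment> \<open>The additional \<open>sqrt n\<close> pays for the rounding loss
      \<open>m^2\<close>. The constant 256 in \<open>E3\<close> is \<open>2 * 8 * 16\<close>, one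
      factor 2 for this addition.\<close>
    have "sqrt (real n) * L powr \<gamma> + sqrt (real n) * 1 \<le> sqrt (real n) * L powr \<gamma> + sqrt (real n) * L powr \<gamma>"
      using L \<gamma> by (intro add_left_mono mult_left_mono ge_one_powr_ge_zero) auto
    also have "\<dots> = (sqrt (real n) * L powr \<gamma>) / (128 * real C) * (256 * real C)"
      using C by simp
    also have "\<dots> \<le> (sqrt (real n) * L powr \<gamma>) / (128 * real C) * L powr (\<beta> - \<gamma>)"
      using elim by (intro mult_left_mono) (auto simp: L_def)
    also have "\<dots> = sqrt (real n) * (L powr \<gamma> * L powr (\<beta> - \<gamma>)) / (128 * real C)" by simp
    also have "L powr \<gamma> * L powr (\<beta> - \<gamma>) = L powr (\<beta> - 1) * L"
      using powr_add[of L \<gamma> "\<beta> - \<gamma>"] powr_add[of L "\<beta> - 1" 1] L by simp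
    also have "sqrt (real n) * (L powr (\<beta> - 1) * L) / (128 * real C) =
        (sqrt (real n) * L powr (\<beta> - 1)) / real (8 * C) * (L / 16)" by simp
    also have "\<dots> \<le> real D / real (8 * C) * (ln (real (m\<^sup>2) + 1) - ln (real m + 1))"
      using star_degree_ge[of n \<beta>] logs L
      by (intro mult_mono divide_right_mono) (auto simp: D_def L_def)
    finally have "sqrt (real n) * L powr \<gamma> + sqrt (real n) \<le>
        real D / real (8 * C) * (ln (real (m\<^sup>2) + 1) - ln (real m + 1))" by simp
    moreover have "real (m\<^sup>2) \<le> sqrt (real n)"
      using order_trans[OF m2(2)[unfolded x_def] elim(2)] by (simp only: of_nat_power)
    moreover have "real D / real (8 * C) * (ln (real (m\<^sup>2) + 1) - ln (real m + 1)) - real (m\<^sup>2)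
        \<le> real (card (spider {m..<m\<^sup>2} (\<lambda>i. D div (8 * C * Suc i))))"
      using C mm by (intro card_spider_ge) auto
    ultimately show ?case unfolding m_def D_def L_def by linarith
  qed
qed

text \<open>With \<open>\<epsilon> = 1 / 2 - \<beta>\<close>, the expression
  \<open>D^2 * ln (2 * D + 1) powr (1 + \<epsilon>)\<close> is at most a constant times
  \<open>n * (ln n) powr (- \<epsilon>)\<close>, because
  \<open>2 * (\<beta> - 1) + 1 + \<epsilon> = - \<epsilon>\<close>. Hence the \<open>n\<close>-th
  power is at most \<open>exp (- c' * (ln n) powr \<epsilon>)\<close>.\<close>

lemma no_star_power_tendsto_0:
  fixes S :: "nat \<Rightarrow> real"
  assumes \<beta>: "0 \<le> \<beta>" "\<beta> < 1 / 2" and c: "0 < c" and S0: "\<And>D. 0 \<le> S D"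
    and S: "\<And>D. 1 \<le> D \<Longrightarrow> S D \<le> 1 - c / ((real D)\<^sup>2 * ln (2 * real D + 1) powr (1 + (1 / 2 - \<beta>)))"
  shows "(\<lambda>n. S (star_degree \<beta> n) ^ n) \<longlonglongrightarrow> 0"
proof -
  define \<epsilon> where "\<epsilon> = 1 / 2 - \<beta>"
  have \<epsilon>: "0 < \<epsilon>" using \<beta> by (simp add: \<epsilon>_def)
  define c' where "c' = c / (4 * 2 powr (1 + \<epsilon>))"
  have c': "0 < c'" using c by (simp add: c'_def)
  have lim: "(\<lambda>n. exp (- (c' * ln (real n) powr \<epsilon>))) \<longlonglongrightarrow> 0"
  proof (rule filterlim_compose[of "\<lambda>y. exp (- (c' * y))"])
    show "((\<lambda>y. exp (- (c' * y))) \<longlongrightarrow> 0) at_top" using c' by real_asymp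
    show "filterlim (\<lambda>n. ln (real n) powr \<epsilon>) at_top sequentially" using \<epsilon> by real_asymp
  qed
  have E1: "eventually (\<lambda>n. 1 \<le> sqrt (real n) / ln (real n)) sequentially" by real_asymp
  have E2: "eventually (\<lambda>n. 4 * sqrt (real n) + 1 \<le> (real n)\<^sup>2) sequentially" by real_asymp
  have "eventually (\<lambda>n. norm (S (star_degree \<beta> n) ^ n) \<le> exp (- (c' * ln (real n) powr \<epsilon>))) sequentially"
    using E1 E2 eventually_ln_ge_1 eventually_gt_at_top[of 0]
  proof eventually_elim
    case (elim n)
    define D L y where "D = star_degree \<beta> n" and "L = ln (real n)"
      and "y = sqrt (real n) * ln (real n) powr (\<beta> - 1)"
    have L: "1 \<le> L" using elim by (simp add: L_def)
    have y1: "1 \<le> y" using elim ln_powr_ge_inverse[OF \<beta>(1), of n] by (simp add: y_def)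
    have D: "y \<le> real D" "real D \<le> y + 1"
      using y1 unfolding D_def star_degree_def y_def[symmetric] by linarith+
    have D1: "1 \<le> D" using D y1 by linarith
    have D2: "real D \<le> 2 * y" using D y1 by linarith
    have "L powr (\<beta> - 1) \<le> 1" using powr_mono[of "\<beta> - 1" 0 L] L \<beta> by simp
    then have "y \<le> sqrt (real n) * 1" unfolding y_def L_def[symmetric] by (intro mult_left_mono) auto
    then have "2 * real D + 1 \<le> (real n)\<^sup>2" using D2 elim by linarith
    then have "ln (2 * real D + 1) \<le> ln ((real n)\<^sup>2)" by (subst ln_le_cancel_iff) (use elim in auto)
    also have "\<dots> = 2 * L" using elim by (simp add: L_def ln_realpow)
    finally have ln2: "ln (2 * real D + 1) \<le> 2 * L" .
    have ln0: "0 < ln (2 * real D + 1)" using D1 by simp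
    have "(real D)\<^sup>2 * ln (2 * real D + 1) powr (1 + \<epsilon>) \<le> (2 * y)\<^sup>2 * (2 * L) powr (1 + \<epsilon>)"
      using D2 ln2 ln0 \<epsilon> by (intro mult_mono power_mono powr_mono2) auto
    also have "\<dots> = real n * (4 * 2 powr (1 + \<epsilon>)) * (L powr (\<beta> - 1) * L powr (\<beta> - 1) * L powr (1 + \<epsilon>))"
      using L unfolding y_def L_def[symmetric] by (simp add: power2_eq_square powr_mult)
    also have "L powr (\<beta> - 1) * L powr (\<beta> - 1) * L powr (1 + \<epsilon>) = L powr (- \<epsilon>)"
      unfolding powr_add[symmetric] by (simp add: \<epsilon>_def)
    finally have bound: "(real D)\<^sup>2 * ln (2 * real D + 1) powr (1 + \<epsilon>) \<le>
        real n * (4 * 2 powr (1 + \<epsilon>)) * L powr (- \<epsilon>)" .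
    have "c' * L powr \<epsilon> = real n * (c / (real n * (4 * 2 powr (1 + \<epsilon>)) * L powr (- \<epsilon>)))"
      using elim L by (simp add: c'_def powr_minus field_simps)
    also have "\<dots> \<le> real n * (c / ((real D)\<^sup>2 * ln (2 * real D + 1) powr (1 + \<epsilon>)))"
      using bound c D1 ln0 L elim by (intro mult_left_mono divide_left_mono mult_pos_pos) auto
    finally have key: "c' * L powr \<epsilon> \<le> real n * (c / ((real D)\<^sup>2 * ln (2 * real D + 1) powr (1 + \<epsilon>)))" .
    have "S D \<le> 1 - c / ((real D)\<^sup>2 * ln (2 * real D + 1) powr (1 + \<epsilon>))"
      using S[OF D1] by (simp add: \<epsilon>_def)
    also have "\<dots> \<le> exp (- (c / ((real D)\<^sup>2 * ln (2 * real D + 1) powr (1 + \<epsilon>))))"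
      using exp_ge_add_one_self[of "- (c / ((real D)\<^sup>2 * ln (2 * real D + 1) powr (1 + \<epsilon>)))"] by linarith
    finally have "S D ^ n \<le> exp (- (c / ((real D)\<^sup>2 * ln (2 * real D + 1) powr (1 + \<epsilon>)))) ^ n"
      using S0 by (intro power_mono) auto
    also have "\<dots> = exp (- (real n * (c / ((real D)\<^sup>2 * ln (2 * real D + 1) powr (1 + \<epsilon>)))))"
      by (simp add: exp_of_nat_mult[symmetric])
    also have "\<dots> \<le> exp (- (c' * L powr \<epsilon>))" using key by simp
    finally show ?case using S0 by (simp add: D_def L_def)
  qed
  then show ?thesis using lim by (rule Lim_null_comparison)
qed

text \<open>The last factor \<open>n * sqrt n\<close> comes from dividing by the probability of size
  \<open>n\<close>.\<close>

lemma legs_error_tendsto_0: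
  "(\<lambda>n. real n * (real ((leg_start n)\<^sup>2) * exp (- real (leg_start n))) * (real n * sqrt (real n))) \<longlonglongrightarrow> 0"
proof (rule Lim_null_comparison)
  let ?x = "\<lambda>n. real n powr (1 / 8)"
  show "(\<lambda>n. real n * ((?x n)\<^sup>2 * exp (1 - ?x n)) * (real n * sqrt (real n))) \<longlonglongrightarrow> 0"
    by real_asymp
  show "eventually (\<lambda>n. norm (real n * (real ((leg_start n)\<^sup>2) * exp (- real (leg_start n))) *
      (real n * sqrt (real n))) \<le> real n * ((?x n)\<^sup>2 * exp (1 - ?x n)) * (real n * sqrt (real n))) sequentially"
  proof (intro always_eventually allI)
    fix n
    have "real ((leg_start n)\<^sup>2) \<le> (?x n)\<^sup>2"
      using leg_start_bounds(1)[of n] by (simp add: power_mono)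
    moreover have "exp (- real (leg_start n)) \<le> exp (1 - ?x n)"
      using leg_start_bounds(2)[of n] by simp
    ultimately have "real n * (real ((leg_start n)\<^sup>2) * exp (- real (leg_start n))) * (real n * sqrt (real n))
        \<le> real n * ((?x n)\<^sup>2 * exp (1 - ?x n)) * (real n * sqrt (real n))"
      by (intro mult_right_mono mult_left_mono mult_mono) auto
    then show "norm (real n * (real ((leg_start n)\<^sup>2) * exp (- real (leg_start n))) *
      (real n * sqrt (real n))) \<le> real n * ((?x n)\<^sup>2 * exp (1 - ?x n)) * (real n * sqrt (real n))"
      by simp
  qed
qed

theorem theorem1p3:
  fixes \<gamma> :: real
  assumes "\<gamma> < 1 / 2"
  shows "\<exists>\<mu> :: nat pmf.
    (\<lambda>k. real k * pmf \<mu> k) sums 1 \<and>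
    pmf \<mu> 0 > 0 \<and>
    summable (\<lambda>k. (real k)\<^sup>2 * pmf \<mu> k) \<and>
    ((\<lambda>n. measure (measure_spmf (pair_spmf (conditioned_bienayme \<mu> n) (conditioned_bienayme \<mu> n)))
            {(t, t'). real (LCS t t') \<ge> sqrt (real n) * ln (real n) powr \<gamma>})
      \<longlongrightarrow> 1) (inf sequentially (principal (admissible_sizes \<mu>)))"
proof -
  \<comment> \<open>A negative \<gamma> may be replaced by 0 once \<open>ln n \<ge> 1\<close>;
    \<beta> is then the midpoint between \<open>\<gamma>0\<close> and \<open>1 / 2\<close>.\<close>
  define \<gamma>0 where "\<gamma>0 = max \<gamma> 0"
  define \<beta> where "\<beta> = (\<gamma>0 + 1 / 2) / 2"
  have \<gamma>0: "0 \<le> \<gamma>0" "\<gamma> \<le> \<gamma>0" "\<gamma>0 < \<beta>" and \<beta>: "0 \<le> \<beta>" "\<beta> < 1 / 2"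
    using assms by (auto simp: \<gamma>0_def \<beta>_def)
  have "0 < 1 / 2 - \<beta>" using \<beta> by simp
  from ex_heavy_tail[OF this] obtain h c where h: "\<And>k. 0 \<le> h k" "0 < h 0" "h sums 1"
      "(\<lambda>k. real k * h k) sums (1 / 2)" "summable (\<lambda>k. (real k)\<^sup>2 * h k)" and c: "0 < c"
      and tail: "\<And>D. D \<ge> 1 \<Longrightarrow>
        (\<Sum>k<D. h k) \<le> 1 - c / ((real D)\<^sup>2 * ln (2 * real D + 1) powr (1 + (1 / 2 - \<beta>)))"
    by blast
  define \<phi> where "\<phi> = coin_fps * Abs_fps h"
  note moments = coin_offspring_moments[OF h(3-5), folded \<phi>_def]
  have "0 \<le> \<phi> $ k" for k unfolding \<phi>_def coin_fps_mult_nth using h(1) by simp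
  from ex_pmf_of_sums[OF this moments(1)] obtain \<mu> where \<mu>: "\<And>k. pmf \<mu> k = \<phi> $ k" by blast
  have mean: "(\<lambda>k. real k * pmf \<mu> k) sums 1" using moments(2) by (simp add: \<mu>)
  have square: "summable (\<lambda>k. (real k)\<^sup>2 * pmf \<mu> k)" using moments(3) by (simp add: \<mu>)
  have pos: "0 < pmf \<mu> 0" unfolding \<mu> \<phi>_def coin_fps_mult_nth using h(2) by simp
  note int1 = pmf_integral_of_sums[OF of_nat_0_le_iff mean]
  note int2 = pmf_integral_of_sums(1)[OF zero_le_power2 summable_sums[OF square]]
  define C where "C = nat \<lceil>2 * (\<integral>k. (real k)\<^sup>2 \<partial>measure_pmf \<mu>)\<rceil> + 1"
  have C: "1 \<le> C" "2 * (\<integral>k. (real k)\<^sup>2 \<partial>measure_pmf \<mu>) \<le> real C"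
    unfolding C_def by (simp, linarith)
  have "\<exists>c>0. \<exists>N. \<forall>n\<ge>N. c / sqrt (real n) \<le> (\<phi> ^ n) $ (n - 1)"
    unfolding \<phi>_def
    by (rule coin_mult_power_lower[where v = "\<Sum>k. (real k)\<^sup>2 * h k"])
       (use h summable_sums[OF h(5)] in simp_all)
  then obtain c' N where c': "0 < c'"
    and lower: "\<And>n. N \<le> n \<Longrightarrow> c' / sqrt (real n) \<le> (\<phi> ^ n) $ (n - 1)" by blast
  have offspring: "offspring_fps \<mu> UNIV = \<phi>" by (rule fps_ext) (simp add: offspring_fps_def \<mu>)
  define S where "S D = (\<Sum>k<D. h k)" for D
  have S0: "0 \<le> S D" for D unfolding S_def using h(1) by (intro sum_nonneg) auto
  define V where "V n = spider {leg_start n..<(leg_start n)\<^sup>2} (\<lambda>i. star_degree \<beta> n div (8 * C * Suc i))" for n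
  \<comment> \<open>Bounds the conditional probability that the spider does not embed. In the star
    term the factors \<open>n * sqrt n\<close> of numerator and denominator have cancelled.\<close>
  define r where "r n = (S (star_degree \<beta> n) ^ n +
      real n * (real ((leg_start n)\<^sup>2) * exp (- real (leg_start n))) * (real n * sqrt (real n))) / c'" for n
  have "(\<lambda>n. S (star_degree \<beta> n) ^ n) \<longlonglongrightarrow> 0"
    using tail unfolding S_def[symmetric] by (intro no_star_power_tendsto_0[OF \<beta> c S0])
  then have "r \<longlonglongrightarrow> (0 + 0) / c'"
    unfolding r_def using c'
    by (intro tendsto_divide tendsto_add tendsto_const legs_error_tendsto_0) simp_all
  then have r: "r \<longlonglongrightarrow> 0" by simp
  let ?p = "bienayme \<mu>"
  let ?X = "\<lambda>n. measure (measure_spmf (pair_spmf (conditioned_bienayme \<mu> n) (conditioned_bienayme \<mu> n)))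
            {(t, t'). real (LCS t t') \<ge> sqrt (real n) * ln (real n) powr \<gamma>}"
  have "eventually (\<lambda>n. r n < 1) sequentially" by (rule order_tendstoD(2)[OF r]) simp
  then have "eventually (\<lambda>n. (1 - r n) * (1 - r n) \<le> ?X n) sequentially"
    using eventually_ge_at_top[of N] eventually_gt_at_top[of 0] eventually_ln_ge_1
      eventually_legs_le_star_degree[OF \<beta>(1) C(1)] eventually_spider_large[OF \<gamma>0(1,3) C(1)]
  proof eventually_elim
    case (elim n)
    have n: "0 < n" using elim by simp
    define q where "q = sprob ?p (\<lambda>t. num_vertices t = n)"
    \<comment> \<open>The coefficient is of order at least \<open>1 / sqrt n\<close>, and the cycle
      lemma contributes another \<open>1 / n\<close>.\<close>
    have q: "c' / (real n * sqrt (real n)) \<le> q"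
      using divide_right_mono[OF lower[OF elim(2)], of "real n"]
      unfolding q_def sprob_size[OF n] offspring by (simp add: mult.commute)
    have q0: "0 < q" using q c' n by (smt (verit) divide_pos_pos mult_pos_pos of_nat_0_less_iff real_sqrt_gt_zero)
    let ?b = "sprob ?p (\<lambda>t. num_vertices t = n \<and> \<not> embeds (V n) t)"
    have "?b \<le> (offspring_fps \<mu> {..<star_degree \<beta> n} ^ n) $ (n - 1) / real n +
        real n * (real ((leg_start n)\<^sup>2) * exp (- real (leg_start n)))"
      unfolding V_def by (rule sprob_not_embeds_le[OF int1 int2 C elim(5) n])
    also have "(offspring_fps \<mu> {..<star_degree \<beta> n} ^ n) $ (n - 1) \<le> S (star_degree \<beta> n) ^ n / sqrt (real n)"
      unfolding S_def by (rule offspring_power_upper[OF h(1) _ n]) (simp add: \<mu> \<phi>_def)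
    also have "S (star_degree \<beta> n) ^ n / sqrt (real n) / real n +
        real n * (real ((leg_start n)\<^sup>2) * exp (- real (leg_start n))) = r n * (c' / (real n * sqrt (real n)))"
      using c' n by (simp add: r_def field_simps)
    also have "\<dots> \<le> r n * q"
    proof (rule mult_left_mono[OF q])
      show "0 \<le> r n" unfolding r_def using S0 c' by (intro divide_nonneg_pos add_nonneg_nonneg) auto
    qed
    finally have b: "?b \<le> r n * q" using n by (simp add: divide_right_mono)
    define P where "P = sprob (conditioned_bienayme \<mu> n) (embeds (V n))"
    have "q = sprob ?p (\<lambda>t. (num_vertices t = n \<and> embeds (V n) t) \<or> (num_vertices t = n \<and> \<not> embeds (V n) t))"
      unfolding q_def by (rule sprob_cong) blast
    also have "\<dots> \<le> sprob ?p (\<lambda>t. num_vertices t = n \<and> embeds (V n) t) + ?b" by (rule sprob_disj_le)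
    finally have "q - r n * q \<le> sprob ?p (\<lambda>t. num_vertices t = n \<and> embeds (V n) t)" using b by linarith
    then have "(q - r n * q) / q \<le> P"
      unfolding P_def conditioned_bienayme_def sprob_cond_spmf q_def
      by (simp add: divide_right_mono)
    then have "1 - r n \<le> P" using q0 by (simp add: diff_divide_distrib)
    \<comment> \<open>By independence both trees contain the same spider with probability
      \<open>P * P\<close>; \<open>r n < 1\<close> permits squaring the bound.\<close>
    then have "(1 - r n) * (1 - r n) \<le> P * P" using elim(1) by (intro mult_mono) auto
    also have "P * P = sprob (pair_spmf (conditioned_bienayme \<mu> n) (conditioned_bienayme \<mu> n))
        (\<lambda>(t, t'). embeds (V n) t \<and> embeds (V n) t')"
      unfolding P_def by (rule sprob_pair[symmetric])
    also have "\<dots> \<le> sprob (pair_spmf (conditioned_bienayme \<mu> n) (conditioned_bienayme \<mu> n))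
        (\<lambda>(t, t'). real (LCS t t') \<ge> sqrt (real n) * ln (real n) powr \<gamma>)"
    proof (rule sprob_mono, clarify)
      fix t t' assume "embeds (V n) t" "embeds (V n) t'"
      then have "card (V n) \<le> LCS t t'" unfolding V_def by (intro LCS_ge_card_spider) auto
      moreover have "sqrt (real n) * ln (real n) powr \<gamma> \<le> sqrt (real n) * ln (real n) powr \<gamma>0"
        using elim(4) \<gamma>0 by (intro mult_left_mono powr_mono) auto
      ultimately show "sqrt (real n) * ln (real n) powr \<gamma> \<le> real (LCS t t')"
        using elim(6) unfolding V_def by linarith
    qed
    finally show ?case by simp
  qed
  moreover have "(\<lambda>n. (1 - r n) * (1 - r n)) \<longlonglongrightarrow> 1" using r by (auto intro!: tendsto_eq_intros)
  ultimately have "?X \<longlonglongrightarrow> 1"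
    by (intro tendsto_sandwich[of _ ?X sequentially "\<lambda>_. 1"])
       (auto intro: always_eventually measure_spmf.subprob_measure_le_1)
  \<comment> \<open>The limit was obtained along all \<open>n\<close>, so it persists along the
    coarser-restricted filter of admissible sizes.\<close>
  then have "(?X \<longlongrightarrow> 1) (inf sequentially (principal (admissible_sizes \<mu>)))"
    by (rule tendsto_mono[OF inf_le1])
  with mean pos square show ?thesis by blast
qed

end
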